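(* Let $K:\mathcal{S}\to\mathcal{T}$ be a morphism of preorder-varietal algebraic theories. Then the ordered algebraic functor $\mathsf{Alg}(\mathcal{T},\mathcal{P}os)\to\mathsf{Alg}(\mathcal{S},\mathcal{P}os)$, $A\mapsto AK$, is strongly order-solid, and the preordered algebraic functor $\mathsf{Alg}(\mathcal{T},\mathcal{O}rd)\to\mathsf{Alg}(\mathcal{S},\mathcal{O}rd)$, $A\mapsto AK$, is strongly preorder-solid.
   Context: $\mathcal{P}os$ is the category of partially ordered sets and monotone maps; $\mathcal{O}rd$ is the category of preordered sets and monotone maps. An ordered (respectively preordered) category is a category whose hom-sets carry a partial order (respectively preorder) preserved by composition from either side; an ordered (preordered) functor between such categories is a functor whose hom-maps are monotone. $\mathcal{P}os$ and $\mathcal{O}rd$ are themselves (pre)ordered by the pointwise order of maps. Let $P:\mathcal{A}\to\mathcal{X}$ be an ordered (preordered) functor. A morphism $q:X\to PA$ with $A\in\mathrm{ob}\,\mathcal{A}$ is order-$P$-epic (preorder-$P$-epic) if, for all $r,s:A\to B$ in $\mathcal{A}$, $Pr\cdot q\le Ps\cdot q$ implies $r\le s$. $P$ is order-right adjoint (preorder-right adjoint) if for every object $X$ of $\mathcal{X}$ there is a $P$-universal arrow $e:X\to PA$ (every $f:X\to PB$ is $f=Pt\cdot e$ for a unique $t:A\to B$) which is order-$P$-epic (preorder-$P$-epic). $P$ is strongly order-solid (strongly preorder-solid) if for every (possibly empty, possibly proper-class-sized) family $D=(D_i)_{i\in I}$ of $\mathcal{A}$-objects and every family $\xi=(\xi_i:PD_i\to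 X)_{i\in I}$ of $\mathcal{X}$-morphisms there are a family $\alpha=(\alpha_i:D_i\to A)_{i\in I}$ in $\mathcal{A}$ and a morphism $q:X\to PA$ such that: 1. $P\alpha_i=q\cdot\xi_i$ for all $i$; 2. for every family $\beta=(\beta_i:D_i\to B)_{i\in I}$ in $\mathcal{A}$ and every $f:X\to PB$ with $P\beta_i=f\cdot\xi_i$ for all $i$ there is a unique $t:A\to B$ in $\mathcal{A}$ with $t\cdot\alpha_i=\beta_i$ for all $i$ and $Pt\cdot q=f$; 3. $q$ is order-$P$-epic (preorder-$P$-epic). An (infinitary) algebraic theory $\mathcal{T}$ is a category whose class of objects is the class of cardinal numbers, such that every cardinal $n$ is the $n$-fold power of $1$ in $\mathcal{T}$. An ordered $\mathcal{T}$-algebra is a product-preserving functor $A:\mathcal{T}\to\mathcal{P}os$; its underlying ordered set $A^1$ is the value of $A$ at $1$. A monotone $\mathcal{T}$-homomorphism is a natural transformation of such functors. $\mathsf{Alg}(\mathcal{T},\mathcal{P}os)$ denotes the resulting category, with hom-sets ordered by the pointwise order of the underlying monotone maps (the components at $1$). Replacing $\mathcal{P}os$ by $\mathcal{O}rd$ gives the preordered category $\mathsf{Alg}(\mathcal{T},\mathcal{O}rd)$ of preordered $\mathcal{T}$-algebras. The theory $\mathcal{T}$ is preorder-varietal if the functor $(-)^1:\mathsf{Alg}(\mathcal{T},\mathcal{O}rd)\to\mathcal{O}rd$, $A\mapsto A^1$, is preorder-right adjoint. A morphism $K:\mathcal{S}\to\mathcal{T}$ of algebraic theories is a functor that maps objects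 identically and preserves their status as direct products (powers of $1$). It induces the (pre)ordered algebraic functors by precomposition, $A\mapsto AK$. *)

theory Defs
  imports Main "HOL-Library.FuncSet"
begin

unbundle cardinal_syntax

section \<open>Sets, classes and cardinal numbers\<close>

text \<open>
  Sets are the subsets of a type \<open>'u\<close> of cardinality below that of \<open>'u\<close>; classes are arbitrary
  HOL sets, over any type. When \<open>'u\<close> has inaccessible cardinality, this is the usual
  distinction between the elements and the subclasses of a Grothendieck universe;
  what is needed of it below is only that the cardinality of \<open>'u\<close> be infinite and regular.
\<close>

definition small :: "'u set \<Rightarrow> bool" where
  "small A \<longleftrightarrow> |A| <o |UNIV :: 'u set|"

text \<open>
  \<open>|UNIV :: 'u set|\<close> is a well-order on \<open>'u\<close> all of whose proper initial segments are small.
  Its elements therefore serve as the ordinal numbers of the universe, each one being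
  identified (as by von Neumann) with the set of its predecessors, and the cardinal numbers
  are the initial ordinals.
\<close>

definition below :: "'u \<Rightarrow> 'u set" where
  "below n = underS |UNIV :: 'u set| n"

definition cardinals :: "'u set" where
  "cardinals = {n. \<forall>m \<in> below n. |below m| <o |below n|}"

definition cardinal_one :: "'u" where
  "cardinal_one = (THE n. n \<in> cardinals \<and> is_singleton (below n))"


section \<open>Categories and functors\<close>

record ('o, 'a) category =
  Ob :: "'o set"
  Arr :: "'a set"
  Dom :: "'a \<Rightarrow> 'o"
  Cod :: "'a \<Rightarrow> 'o"
  Id :: "'o \<Rightarrow> 'a"
  Comp :: "'a \<Rightarrow> 'a \<Rightarrow> 'a" (infixl \<open>\<cdot>\<index>\<close> 70)

definition Hom :: "('o, 'a, 'z) category_scheme \<Rightarrow> 'o \<Rightarrow> 'o \<Rightarrow> 'a set" where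
  "Hom C a b = {f \<in> Arr C. Dom C f = a \<and> Cod C f = b}"

definition is_category :: "('o, 'a, 'z) category_scheme \<Rightarrow> bool" where
  "is_category C \<longleftrightarrow>
     (\<forall>f \<in> Arr C. Dom C f \<in> Ob C \<and> Cod C f \<in> Ob C) \<and>
     (\<forall>a \<in> Ob C. Id C a \<in> Hom C a a) \<and>
     (\<forall>a \<in> Ob C. \<forall>b \<in> Ob C. \<forall>c \<in> Ob C. \<forall>f \<in> Hom C a b. \<forall>g \<in> Hom C b c. g \<cdot>\<^bsub>C\<^esub> f \<in> Hom C a c) \<and>
     (\<forall>a \<in> Ob C. \<forall>b \<in> Ob C. \<forall>f \<in> Hom C a b. f \<cdot>\<^bsub>C\<^esub> Id C a = f \<and> Id C b \<cdot>\<^bsub>C\<^esub> f = f) \<and>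
     (\<forall>a \<in> Ob C. \<forall>b \<in> Ob C. \<forall>c \<in> Ob C. \<forall>d \<in> Ob C.
        \<forall>f \<in> Hom C a b. \<forall>g \<in> Hom C b c. \<forall>h \<in> Hom C c d.
          h \<cdot>\<^bsub>C\<^esub> (g \<cdot>\<^bsub>C\<^esub> f) = (h \<cdot>\<^bsub>C\<^esub> g) \<cdot>\<^bsub>C\<^esub> f)"

record ('o, 'a, 'p, 'b) cfunctor =
  omap :: "'o \<Rightarrow> 'p"
  amap :: "'a \<Rightarrow> 'b"

definition is_functor ::
  "('o, 'a, 'z) category_scheme \<Rightarrow> ('p, 'b, 'y) category_scheme \<Rightarrow>
   ('o, 'a, 'p, 'b) cfunctor \<Rightarrow> bool" where
  "is_functor C D F \<longleftrightarrow>
     (\<forall>a \<in> Ob C. omap F a \<in> Ob D) \<and>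
     (\<forall>a \<in> Ob C. \<forall>b \<in> Ob C. \<forall>f \<in> Hom C a b. amap F f \<in> Hom D (omap F a) (omap F b)) \<and>
     (\<forall>a \<in> Ob C. amap F (Id C a) = Id D (omap F a)) \<and>
     (\<forall>a \<in> Ob C. \<forall>b \<in> Ob C. \<forall>c \<in> Ob C. \<forall>f \<in> Hom C a b. \<forall>g \<in> Hom C b c.
        amap F (g \<cdot>\<^bsub>C\<^esub> f) = amap F g \<cdot>\<^bsub>D\<^esub> amap F f)"

definition is_product ::
  "('o, 'a, 'z) category_scheme \<Rightarrow> 'i set \<Rightarrow> ('i \<Rightarrow> 'o) \<Rightarrow> 'o \<Rightarrow> ('i \<Rightarrow> 'a) \<Rightarrow> bool" where
  "is_product C I d n p \<longleftrightarrow>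
     n \<in> Ob C \<and> (\<forall>i \<in> I. d i \<in> Ob C \<and> p i \<in> Hom C n (d i)) \<and>
     (\<forall>m \<in> Ob C. \<forall>q. (\<forall>i \<in> I. q i \<in> Hom C m (d i)) \<longrightarrow>
        (\<exists>!h. h \<in> Hom C m n \<and> (\<forall>i \<in> I. p i \<cdot>\<^bsub>C\<^esub> h = q i)))"

definition preserves_products ::
  "('o, 'a, 'z) category_scheme \<Rightarrow> ('p, 'b, 'y) category_scheme \<Rightarrow>
   ('o, 'a, 'p, 'b) cfunctor \<Rightarrow> 'u itself \<Rightarrow> bool" where
  "preserves_products C D F u \<longleftrightarrow>
     (\<forall>(I :: 'u set) d n p. small I \<longrightarrow> is_product C I d n p \<longrightarrow>
        is_product D I (\<lambda>i. omap F (d i)) (omap F n) (\<lambda>i. amap F (p i)))"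


section \<open>Ordered and preordered categories\<close>

record ('o, 'a) ocategory = "('o, 'a) category" +
  Le :: "'a \<Rightarrow> 'a \<Rightarrow> bool"

text \<open>\<open>Le\<close> is only meaningful between arrows of the same hom-set.\<close>

definition preordered_category :: "('o, 'a, 'z) ocategory_scheme \<Rightarrow> bool" where
  "preordered_category C \<longleftrightarrow>
     is_category C \<and>
     (\<forall>a \<in> Ob C. \<forall>b \<in> Ob C. \<forall>f \<in> Hom C a b. Le C f f) \<and>
     (\<forall>a \<in> Ob C. \<forall>b \<in> Ob C. \<forall>f \<in> Hom C a b. \<forall>g \<in> Hom C a b. \<forall>h \<in> Hom C a b.
        Le C f g \<longrightarrow> Le C g h \<longrightarrow> Le C f h) \<and>
     (\<forall>a \<in> Ob C. \<forall>b \<in> Ob C. \<forall>c \<in> Ob C.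
        \<forall>f \<in> Hom C a b. \<forall>f' \<in> Hom C a b. \<forall>g \<in> Hom C b c. \<forall>g' \<in> Hom C b c.
          (Le C f f' \<longrightarrow> Le C (g \<cdot>\<^bsub>C\<^esub> f) (g \<cdot>\<^bsub>C\<^esub> f')) \<and>
          (Le C g g' \<longrightarrow> Le C (g \<cdot>\<^bsub>C\<^esub> f) (g' \<cdot>\<^bsub>C\<^esub> f)))"

definition ordered_category :: "('o, 'a, 'z) ocategory_scheme \<Rightarrow> bool" where
  "ordered_category C \<longleftrightarrow>
     preordered_category C \<and>
     (\<forall>a \<in> Ob C. \<forall>b \<in> Ob C. \<forall>f \<in> Hom C a b. \<forall>g \<in> Hom C a b.
        Le C f g \<longrightarrow> Le C g f \<longrightarrow> f = g)"

definition monotone_on_homs ::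
  "('o, 'a, 'z) ocategory_scheme \<Rightarrow> ('p, 'b, 'y) ocategory_scheme \<Rightarrow>
   ('o, 'a, 'p, 'b) cfunctor \<Rightarrow> bool" where
  "monotone_on_homs C D F \<longleftrightarrow>
     (\<forall>a \<in> Ob C. \<forall>b \<in> Ob C. \<forall>f \<in> Hom C a b. \<forall>g \<in> Hom C a b.
        Le C f g \<longrightarrow> Le D (amap F f) (amap F g))"

definition preordered_functor ::
  "('o, 'a, 'z) ocategory_scheme \<Rightarrow> ('p, 'b, 'y) ocategory_scheme \<Rightarrow>
   ('o, 'a, 'p, 'b) cfunctor \<Rightarrow> bool" where
  "preordered_functor C D F \<longleftrightarrow>
     preordered_category C \<and> preordered_category D \<and> is_functor C D F \<and> monotone_on_homs C D F"

definition ordered_functor ::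
  "('o, 'a, 'z) ocategory_scheme \<Rightarrow> ('p, 'b, 'y) ocategory_scheme \<Rightarrow>
   ('o, 'a, 'p, 'b) cfunctor \<Rightarrow> bool" where
  "ordered_functor C D F \<longleftrightarrow>
     ordered_category C \<and> ordered_category D \<and> is_functor C D F \<and> monotone_on_homs C D F"

text \<open>
  The following notions are given by the same formula in the ordered and in the preordered
  case; which of the two is meant depends only on whether \<open>P\<close> is an ordered or a preordered
  functor.
\<close>

definition order_epic ::
  "('o, 'a, 'z) ocategory_scheme \<Rightarrow> ('p, 'b, 'y) ocategory_scheme \<Rightarrow>
   ('o, 'a, 'p, 'b) cfunctor \<Rightarrow> 'o \<Rightarrow> 'b \<Rightarrow> bool" where
  "order_epic A X P a q \<longleftrightarrow>
     (\<forall>b \<in> Ob A. \<forall>r \<in> Hom A a b. \<forall>s \<in> Hom A a b.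
        Le X (amap P r \<cdot>\<^bsub>X\<^esub> q) (amap P s \<cdot>\<^bsub>X\<^esub> q) \<longrightarrow> Le A r s)"

definition universal_arrow ::
  "('o, 'a, 'z) ocategory_scheme \<Rightarrow> ('p, 'b, 'y) ocategory_scheme \<Rightarrow>
   ('o, 'a, 'p, 'b) cfunctor \<Rightarrow> 'p \<Rightarrow> 'o \<Rightarrow> 'b \<Rightarrow> bool" where
  "universal_arrow A X P x a e \<longleftrightarrow>
     a \<in> Ob A \<and> e \<in> Hom X x (omap P a) \<and>
     (\<forall>b \<in> Ob A. \<forall>f \<in> Hom X x (omap P b). \<exists>!t. t \<in> Hom A a b \<and> amap P t \<cdot>\<^bsub>X\<^esub> e = f)"

definition order_right_adjoint ::
  "('o, 'a, 'z) ocategory_scheme \<Rightarrow> ('p, 'b, 'y) ocategory_scheme \<Rightarrow>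
   ('o, 'a, 'p, 'b) cfunctor \<Rightarrow> bool" where
  "order_right_adjoint A X P \<longleftrightarrow>
     (\<forall>x \<in> Ob X. \<exists>a e. universal_arrow A X P x a e \<and> order_epic A X P a e)"

text \<open>
  The type \<open>'i\<close> supplies the index classes of the families; they are arbitrary subsets of it,
  not required to be small.
\<close>

definition strongly_order_solid ::
  "'i itself \<Rightarrow> ('o, 'a, 'z) ocategory_scheme \<Rightarrow> ('p, 'b, 'y) ocategory_scheme \<Rightarrow>
   ('o, 'a, 'p, 'b) cfunctor \<Rightarrow> bool" where
  "strongly_order_solid i A X P \<longleftrightarrow>
     (\<forall>(I :: 'i set) D x \<xi>.
        x \<in> Ob X \<longrightarrow> (\<forall>i \<in> I. D i \<in> Ob A \<and> \<xi> i \<in> Hom X (omap P (D i)) x) \<longrightarrow>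
        (\<exists>a \<alpha> q.
           a \<in> Ob A \<and> (\<forall>i \<in> I. \<alpha> i \<in> Hom A (D i) a) \<and> q \<in> Hom X x (omap P a) \<and>
           (\<forall>i \<in> I. amap P (\<alpha> i) = q \<cdot>\<^bsub>X\<^esub> \<xi> i) \<and>
           (\<forall>b \<in> Ob A. \<forall>\<beta> f.
              (\<forall>i \<in> I. \<beta> i \<in> Hom A (D i) b) \<longrightarrow> f \<in> Hom X x (omap P b) \<longrightarrow>
              (\<forall>i \<in> I. amap P (\<beta> i) = f \<cdot>\<^bsub>X\<^esub> \<xi> i) \<longrightarrow>
              (\<exists>!t. t \<in> Hom A a b \<and> (\<forall>i \<in> I. t \<cdot>\<^bsub>A\<^esub> \<alpha> i = \<beta> i) \<and> amap P t \<cdot>\<^bsub>X\<^esub> q = f)) \<and>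
           order_epic A X P a q))"


section \<open>Ordered and preordered sets\<close>

datatype ('o, 'f) arrow = Arrow (src: 'o) (tgt: 'o) (content: 'f)

text \<open>
  A preordered set is represented by its preorder relation \<open>r\<close>, from which the underlying set
  is recovered as \<open>Field r\<close> by reflexivity.
\<close>

definition monotone_category :: "'u rel set \<Rightarrow> ('u rel, ('u rel, 'u \<Rightarrow> 'u) arrow) ocategory" where
  "monotone_category \<O> =
     \<lparr> Ob = \<O>,
       Arr = {Arrow r s f | r s f. r \<in> \<O> \<and> s \<in> \<O> \<and> f \<in> Field r \<rightarrow>\<^sub>E Field s \<and>
                (\<forall>(x, y) \<in> r. (f x, f y) \<in> s)},
       Dom = src,
       Cod = tgt,
       Id = (\<lambda>r. Arrow r r (\<lambda>x \<in> Field r. x)),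
       Comp = (\<lambda>g f. Arrow (src f) (tgt g) (compose (Field (src f)) (content g) (content f))),
       Le = (\<lambda>f g. \<forall>x \<in> Field (src f). (content f x, content g x) \<in> tgt f) \<rparr>"

definition Ord :: "('u rel, ('u rel, 'u \<Rightarrow> 'u) arrow) ocategory" where
  "Ord = monotone_category {r. Preorder r \<and> small (Field r)}"

definition Pos :: "('u rel, ('u rel, 'u \<Rightarrow> 'u) arrow) ocategory" where
  "Pos = monotone_category {r. Partial_order r \<and> small (Field r)}"


section \<open>Algebraic theories and their algebras\<close>

definition algebraic_theory :: "('u, 't) category \<Rightarrow> bool" where
  "algebraic_theory T \<longleftrightarrow>
     is_category T \<and> Ob T = cardinals \<and>
     (\<forall>n \<in> cardinals. \<exists>p. is_product T (below n) (\<lambda>_. cardinal_one) n p)"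

definition theory_morphism ::
  "('u, 's) category \<Rightarrow> ('u, 't) category \<Rightarrow> ('u, 's, 'u, 't) cfunctor \<Rightarrow> bool" where
  "theory_morphism S T K \<longleftrightarrow>
     is_functor S T K \<and> (\<forall>n \<in> cardinals. omap K n = n) \<and>
     (\<forall>n \<in> cardinals. \<forall>p. is_product S (below n) (\<lambda>_. cardinal_one) n p \<longrightarrow>
        is_product T (below n) (\<lambda>_. cardinal_one) n (\<lambda>i. amap K (p i)))"

type_synonym ('u, 't) algebra = "('u, 't, 'u rel, ('u rel, 'u \<Rightarrow> 'u) arrow) cfunctor"
type_synonym ('u, 't) hom = "(('u, 't) algebra, 'u \<Rightarrow> ('u rel, 'u \<Rightarrow> 'u) arrow) arrow"

text \<open>
  \<open>V\<close> stands for \<open>Pos\<close> or \<open>Ord\<close>. The extensionality requirements make functors and natural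
  transformations determined by their values on the theory.
\<close>

definition algebras ::
  "('u, 't) category \<Rightarrow> ('u rel, ('u rel, 'u \<Rightarrow> 'u) arrow) ocategory \<Rightarrow> ('u, 't) algebra set" where
  "algebras T V =
     {A. is_functor T V A \<and> omap A \<in> extensional (Ob T) \<and> amap A \<in> extensional (Arr T) \<and>
         preserves_products T V A TYPE('u)}"

definition Alg ::
  "('u, 't) category \<Rightarrow> ('u rel, ('u rel, 'u \<Rightarrow> 'u) arrow) ocategory \<Rightarrow>
   (('u, 't) algebra, ('u, 't) hom) ocategory" where
  "Alg T V =
     \<lparr> Ob = algebras T V,
       Arr = {Arrow A B \<tau> | A B \<tau>. A \<in> algebras T V \<and> B \<in> algebras T V \<and>
                \<tau> \<in> extensional (Ob T) \<and>
                (\<forall>n \<in> Ob T. \<tau> n \<in> Hom V (omap A n) (omap B n)) \<and>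
                (\<forall>m \<in> Ob T. \<forall>n \<in> Ob T. \<forall>f \<in> Hom T m n.
                   \<tau> n \<cdot>\<^bsub>V\<^esub> amap A f = amap B f \<cdot>\<^bsub>V\<^esub> \<tau> m)},
       Dom = src,
       Cod = tgt,
       Id = (\<lambda>A. Arrow A A (\<lambda>n \<in> Ob T. Id V (omap A n))),
       Comp = (\<lambda>\<tau> \<sigma>. Arrow (src \<sigma>) (tgt \<tau>) (\<lambda>n \<in> Ob T. content \<tau> n \<cdot>\<^bsub>V\<^esub> content \<sigma> n)),
       Le = (\<lambda>\<sigma> \<tau>. Le V (content \<sigma> cardinal_one) (content \<tau> cardinal_one)) \<rparr>"

definition underlying :: "(('u, 't) algebra, ('u, 't) hom, 'u rel, ('u rel, 'u \<Rightarrow> 'u) arrow) cfunctor" where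
  "underlying = \<lparr> omap = (\<lambda>A. omap A cardinal_one), amap = (\<lambda>\<tau>. content \<tau> cardinal_one) \<rparr>"

definition preorder_varietal :: "('u, 't) category \<Rightarrow> bool" where
  "preorder_varietal T \<longleftrightarrow> order_right_adjoint (Alg T Ord) Ord underlying"

definition reduct ::
  "('u, 's) category \<Rightarrow> ('u, 's, 'u, 't) cfunctor \<Rightarrow> ('u, 't) algebra \<Rightarrow> ('u, 's) algebra" where
  "reduct S K A =
     \<lparr> omap = (\<lambda>n \<in> Ob S. omap A (omap K n)), amap = (\<lambda>f \<in> Arr S. amap A (amap K f)) \<rparr>"

definition algebraic_functor ::
  "('u, 's) category \<Rightarrow> ('u, 's, 'u, 't) cfunctor \<Rightarrow>
   (('u, 't) algebra, ('u, 't) hom, ('u, 's) algebra, ('u, 's) hom) cfunctor" where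
  "algebraic_functor S K =
     \<lparr> omap = reduct S K,
       amap = (\<lambda>\<tau>. Arrow (reduct S K (src \<tau>)) (reduct S K (tgt \<tau>))
                 (\<lambda>n \<in> Ob S. content \<tau> (omap K n))) \<rparr>"

end

theory Submission
  imports Defs
begin

text \<open>
  Let \<open>X\<close> be an \<open>S\<close>-algebra and \<open>\<xi>\<^sub>i : D\<^sub>i K \<rightarrow> X\<close> a family of \<open>S\<close>-homomorphisms. Call \<open>f : X \<rightarrow> B K\<close>
  a cocone if every \<open>f \<xi>\<^sub>i\<close> is a \<open>T\<close>-homomorphism \<open>D\<^sub>i \<rightarrow> B\<close>. A universal cocone \<open>q : X \<rightarrow> A K\<close> is
  found as a quotient of a free algebra. Let \<open>F\<close> be the preordered \<open>T\<close>-algebra that is free on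
  the underlying preordered set of \<open>X\<close>, with unit \<open>e\<close>; it exists because \<open>T\<close> is
  preorder-varietal. A cocone \<open>f\<close> induces a unique homomorphism \<open>h : F \<rightarrow> B\<close> with \<open>h e = f\<close> at
  the object \<open>1\<close>. Factor all these \<open>h\<close> simultaneously through a pointwise surjective
  \<open>p : F \<rightarrow> A\<close> in such a way that the induced \<open>A \<rightarrow> B\<close> jointly reflect equality and order
  (\<open>source_factorization\<close>).

  Equations and inequalities in \<open>A\<close> may therefore be tested in the targets of the cocones. For
  \<open>x\<close> in \<open>X(n)\<close> the element \<open>y\<close> of \<open>F(n)\<close> whose \<open>n\<close> projections are the images under \<open>e\<close> of those
  of \<open>x\<close> satisfies \<open>h y = f x\<close> for all cocones at once. Put \<open>q x = p y\<close>. That \<open>q\<close> is a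
  homomorphism over \<open>S\<close>, and that each \<open>q \<xi>\<^sub>i\<close> is one over \<open>T\<close>, holds because it holds for every
  cocone. By construction each cocone factors through \<open>q\<close>. It does so uniquely, and \<open>q\<close> is
  order-epic, because \<open>p\<close> is surjective and \<open>e\<close> has the corresponding properties.

  Three points need care.

  \<^item> Size: the cocones may form a proper class, but \<open>A(n)\<close> is represented on a subset of \<open>F(n)\<close>,
    which is small. As products are detected in the targets of the cocones and tuples lift to
    \<open>F\<close>, the quotient \<open>A\<close> again preserves products.

  \<^item> Order: ordered algebras are the preordered algebras whose values are posets
    (\<open>algebras_iff_preorders\<close>). If all targets \<open>B\<close> are ordered, so is \<open>A\<close>, since its points are
    separated by monotone maps into posets. Hence the same free preordered algebra serves both
    halves of the theorem, and both are instances of one argument about a class of preorders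
    that is closed under this kind of separation (\<open>separating_class\<close>).

  \<^item> Reducts: \<open>A K\<close> preserves all small products only if \<open>K\<close> does, whereas a theory morphism is
    merely required to preserve the powers of \<open>1\<close>. Since every object is a power of \<open>1\<close>, a small
    product is a power of \<open>1\<close> over a disjoint union of index sets. By regularity this union
    is again small, so that preservation follows (\<open>theory_morphism_product\<close>).
\<close>

section \<open>Cardinal numbers of the universe\<close>

lemma below_less_iff: "m \<in> below n \<longleftrightarrow> m \<noteq> n \<and> (m, n) \<in> |UNIV :: 'u set|" for m n :: 'u
  by (simp add: below_def underS_def)

lemma below_linear: "m \<in> below n \<or> m = n \<or> n \<in> below m" for m n :: 'u
proof -
  have "total_on (UNIV :: 'u set) |UNIV :: 'u set|"
    using card_of_Well_order[of "UNIV :: 'u set"]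
    by (simp add: well_order_on_def linear_order_on_def Field_card_of)
  then show ?thesis
    by (auto simp: below_less_iff total_on_def)
qed

lemma small_below: "small (below n)"
  unfolding small_def below_def by (rule card_of_underS) (simp_all add: card_of_Card_order card_of_card_order_on Field_card_of)

lemma small_mono: "|A| \<le>o |B| \<Longrightarrow> small B \<Longrightarrow> small A" for A B :: "'u set"
  unfolding small_def using ordLeq_ordLess_trans by blast

lemma small_image: "small A \<Longrightarrow> small (f ` A)" for A :: "'u set" and f :: "'u \<Rightarrow> 'u"
  using small_mono card_of_image by blast

lemma small_finite: "infinite (UNIV :: 'u set) \<Longrightarrow> finite A \<Longrightarrow> small A" for A :: "'u set"
  unfolding small_def
  by (rule finite_ordLess_infinite) (simp_all add: Field_card_of card_of_well_order_on)

text \<open>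
  A small set has the order type, in its cardinal order, of a proper initial segment of the
  universe. An initial segment whose induced order is a cardinal order is exactly what the
  definition of \<open>cardinals\<close> asks for.
\<close>

lemma equipotent_cardinal:
  fixes A :: "'a set"
  assumes "|A| <o |UNIV :: 'u set|"
  obtains m :: 'u and b where "m \<in> cardinals" "bij_betw b (below m) A"
proof -
  let ?r = "|UNIV :: 'u set|"
  obtain m where m: "|A| =o Restr ?r (below m)"
    using assms unfolding ordLess_iff_ordIso_Restr[OF card_of_Well_order card_of_Well_order] below_def
    by (elim bexE)
  define s where "s = Restr ?r (below m)"
  have s: "Card_order s"
    unfolding s_def by (rule Card_order_ordIso[OF card_of_Card_order ordIso_symmetric[OF m]])
  have refl: "(x, x) \<in> ?r" and trans: "(x, y) \<in> ?r \<Longrightarrow> (y, z) \<in> ?r \<Longrightarrow> (x, z) \<in> ?r"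
    and antisym: "(x, y) \<in> ?r \<Longrightarrow> (y, x) \<in> ?r \<Longrightarrow> x = y" for x y z :: 'u
    using card_of_well_order_on[of "UNIV :: 'u set"] unfolding order_on_defs
    by (simp add: refl_on_def, metis transD, metis antisymD)
  have field: "Field s = below m"
    using refl by (auto simp: s_def Field_def)
  have eq: "|below m| =o |A|"
    using ordIso_transitive[OF card_of_Field_ordIso[OF s]] ordIso_symmetric[OF m] field
    by (simp add: s_def)
  have "|below k| <o |below m|" if "k \<in> below m" for k
  proof -
    have "underS s k = {x \<in> below m. x \<noteq> k \<and> (x, k) \<in> ?r}"
      using that by (auto simp: underS_def s_def)
    moreover have "x \<in> below m" if x: "x \<noteq> k \<and> (x, k) \<in> ?r" for x
      using x \<open>k \<in> below m\<close> trans[of x k m] antisym[of k m] unfolding below_less_iff by blast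
    ultimately have eq: "underS s k = below k"
      unfolding set_eq_iff below_less_iff[of _ k] by blast
    have "|underS s k| <o s"
      by (rule card_of_underS[OF s]) (simp add: field that)
    from ordLess_ordIso_trans[OF this ordIso_symmetric[OF card_of_Field_ordIso[OF s]]]
    show ?thesis
      unfolding eq field .
  qed
  then have "m \<in> cardinals"
    by (simp add: cardinals_def)
  moreover obtain b where "bij_betw b (below m) A"
    using eq card_of_ordIso by blast
  ultimately show thesis
    using that by blast
qed

lemma cardinal_one_in:
  assumes "infinite (UNIV :: 'u set)"
  shows "(cardinal_one :: 'u) \<in> cardinals" "is_singleton (below (cardinal_one :: 'u))"
proof -
  have "|{()}| <o |UNIV :: 'u set|"
    using assms by (intro finite_ordLess_infinite) (simp_all add: Field_card_of card_of_well_order_on)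
  then obtain n :: 'u and b where n: "n \<in> cardinals" "bij_betw b (below n) {()}"
    by (rule equipotent_cardinal)
  have sing: "is_singleton (below n)"
    using bij_betw_same_card[OF n(2)] by (simp add: is_singleton_altdef)
  have uniq: "k = n" if "k \<in> cardinals \<and> is_singleton (below k)" for k :: 'u
  proof -
    have "\<not> |below x| <o |below y|" if xy: "is_singleton (below x)" "is_singleton (below y)" for x y :: 'u
    proof -
      obtain a b where "below x = {a}" "below y = {b}"
        using xy by (auto simp: is_singleton_def)
      then have "bij_betw (\<lambda>_. b) (below x) (below y)"
        by (simp add: bij_betw_def)
      then show ?thesis
        using card_of_ordIso not_ordLess_ordIso by blast
    qed
    then show ?thesis
      using below_linear[of k n] that n(1) sing unfolding cardinals_def by blast
  qed
  have "(cardinal_one :: 'u) = n"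
    unfolding cardinal_one_def
  proof (rule the_equality)
    show "n \<in> cardinals \<and> is_singleton (below n)"
      using n(1) sing ..
  qed (rule uniq)
  then show "(cardinal_one :: 'u) \<in> cardinals" "is_singleton (below (cardinal_one :: 'u))"
    using n(1) sing by simp_all
qed

section \<open>Products in a category\<close>

lemma Hom_obs: "is_category C \<Longrightarrow> f \<in> Hom C a b \<Longrightarrow> a \<in> Ob C \<and> b \<in> Ob C"
  unfolding is_category_def Hom_def by auto

lemma Hom_comp:
  "is_category C \<Longrightarrow> f \<in> Hom C a b \<Longrightarrow> g \<in> Hom C b c \<Longrightarrow> g \<cdot>\<^bsub>C\<^esub> f \<in> Hom C a c"
  using Hom_obs[of C f a b] Hom_obs[of C g b c] unfolding is_category_def by blast

lemma comp_assoc: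
  "is_category C \<Longrightarrow> f \<in> Hom C a b \<Longrightarrow> g \<in> Hom C b c \<Longrightarrow> h \<in> Hom C c d \<Longrightarrow>
   h \<cdot>\<^bsub>C\<^esub> (g \<cdot>\<^bsub>C\<^esub> f) = (h \<cdot>\<^bsub>C\<^esub> g) \<cdot>\<^bsub>C\<^esub> f"
  using Hom_obs[of C f a b] Hom_obs[of C h c d] unfolding is_category_def by blast

lemma comp_id:
  assumes "is_category C" "f \<in> Hom C a b"
  shows "f \<cdot>\<^bsub>C\<^esub> Id C a = f" "Id C b \<cdot>\<^bsub>C\<^esub> f = f"
  using Hom_obs[OF assms] assms unfolding is_category_def by blast+

lemma Hom_id: "is_category C \<Longrightarrow> a \<in> Ob C \<Longrightarrow> Id C a \<in> Hom C a a"
  unfolding is_category_def by blast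

lemma functor_Hom:
  "is_category C \<Longrightarrow> is_functor C D F \<Longrightarrow> f \<in> Hom C a b \<Longrightarrow> amap F f \<in> Hom D (omap F a) (omap F b)"
  using Hom_obs[of C f a b] unfolding is_functor_def by blast

lemma functor_comp:
  "is_category C \<Longrightarrow> is_functor C D F \<Longrightarrow> f \<in> Hom C a b \<Longrightarrow> g \<in> Hom C b c \<Longrightarrow>
   amap F (g \<cdot>\<^bsub>C\<^esub> f) = amap F g \<cdot>\<^bsub>D\<^esub> amap F f"
  using Hom_obs[of C f a b] Hom_obs[of C g b c] unfolding is_functor_def by blast

lemma product_Hom: "is_product C I d n p \<Longrightarrow> i \<in> I \<Longrightarrow> p i \<in> Hom C n (d i)"
  and product_Ob: "is_product C I d n p \<Longrightarrow> n \<in> Ob C"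
  and product_factor_Ob: "is_product C I d n p \<Longrightarrow> i \<in> I \<Longrightarrow> d i \<in> Ob C"
  unfolding is_product_def by auto

lemma product_ex:
  assumes "is_product C I d n p" "m \<in> Ob C" "\<And>i. i \<in> I \<Longrightarrow> q i \<in> Hom C m (d i)"
  obtains h where "h \<in> Hom C m n" "\<And>i. i \<in> I \<Longrightarrow> p i \<cdot>\<^bsub>C\<^esub> h = q i"
  using assms(1-3) unfolding is_product_def by (elim conjE) (drule bspec, assumption, drule spec[of _ q], blast intro: that)

lemma product_eqI:
  assumes "is_category C" "is_product C I d n p" "h \<in> Hom C m n" "k \<in> Hom C m n"
    and "\<And>i. i \<in> I \<Longrightarrow> p i \<cdot>\<^bsub>C\<^esub> h = p i \<cdot>\<^bsub>C\<^esub> k"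
  shows "h = k"
proof -
  have "m \<in> Ob C" "\<forall>i\<in>I. p i \<cdot>\<^bsub>C\<^esub> k \<in> Hom C m (d i)"
    using Hom_obs[OF assms(1,3)] Hom_comp[OF assms(1,4) product_Hom[OF assms(2)]] by blast+
  then have "\<exists>!h. h \<in> Hom C m n \<and> (\<forall>i \<in> I. p i \<cdot>\<^bsub>C\<^esub> h = p i \<cdot>\<^bsub>C\<^esub> k)"
    using assms(2) unfolding is_product_def by (elim conjE) (drule bspec, assumption, drule spec, drule mp, assumption)
  then show ?thesis
    using assms(3-5) by blast
qed

lemma productI:
  assumes "n \<in> Ob C" "\<And>i. i \<in> I \<Longrightarrow> d i \<in> Ob C" "\<And>i. i \<in> I \<Longrightarrow> p i \<in> Hom C n (d i)"
    and "\<And>m q. m \<in> Ob C \<Longrightarrow> (\<And>i. i \<in> I \<Longrightarrow> q i \<in> Hom C m (d i)) \<Longrightarrow>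
           \<exists>h. h \<in> Hom C m n \<and> (\<forall>i \<in> I. p i \<cdot>\<^bsub>C\<^esub> h = q i)"
    and "\<And>m h k. h \<in> Hom C m n \<Longrightarrow> k \<in> Hom C m n \<Longrightarrow>
           (\<And>i. i \<in> I \<Longrightarrow> p i \<cdot>\<^bsub>C\<^esub> h = p i \<cdot>\<^bsub>C\<^esub> k) \<Longrightarrow> h = k"
  shows "is_product C I d n p"
  unfolding is_product_def
proof (intro conjI ballI allI impI)
  fix m q assume m: "m \<in> Ob C" and q: "\<forall>i\<in>I. q i \<in> Hom C m (d i)"
  then obtain h where "h \<in> Hom C m n" "\<forall>i \<in> I. p i \<cdot>\<^bsub>C\<^esub> h = q i"
    using assms(4) by blast
  then show "\<exists>!h. h \<in> Hom C m n \<and> (\<forall>i \<in> I. p i \<cdot>\<^bsub>C\<^esub> h = q i)"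
    using assms(5)[of _ m] by (intro ex1I[of _ h]) auto
qed (use assms in auto)

lemma product_reindex:
  assumes C: "is_category C" and prod: "is_product C I d n p" and b: "bij_betw b J I"
  shows "is_product C J (\<lambda>j. d (b j)) n (\<lambda>j. p (b j))"
proof (rule productI)
  have bJ: "b j \<in> I" if "j \<in> J" for j
    using b that bij_betwE by blast
  let ?c = "inv_into J b"
  have c: "?c i \<in> J" "b (?c i) = i" if "i \<in> I" for i
    using b that by (auto simp: bij_betw_def inv_into_into f_inv_into_f)
  have cb: "?c (b j) = j" if "j \<in> J" for j
    using b that by (simp add: bij_betw_def)
  show "n \<in> Ob C" "\<And>j. j \<in> J \<Longrightarrow> d (b j) \<in> Ob C" "\<And>j. j \<in> J \<Longrightarrow> p (b j) \<in> Hom C n (d (b j))"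
    using prod bJ unfolding is_product_def by auto
  show "\<exists>h. h \<in> Hom C m n \<and> (\<forall>j \<in> J. p (b j) \<cdot>\<^bsub>C\<^esub> h = q j)"
    if m: "m \<in> Ob C" and q: "\<And>j. j \<in> J \<Longrightarrow> q j \<in> Hom C m (d (b j))" for m q
  proof -
    have "q (?c i) \<in> Hom C m (d i)" if "i \<in> I" for i
      using q[OF c(1)[OF that]] c(2)[OF that] by simp
    then obtain h where "h \<in> Hom C m n" "\<And>i. i \<in> I \<Longrightarrow> p i \<cdot>\<^bsub>C\<^esub> h = q (?c i)"
      using product_ex[OF prod m, of "\<lambda>i. q (?c i)"] by blast
    then show ?thesis
      by (intro exI[of _ h]) (simp add: bJ cb)
  qed
  show "h = k"
    if "h \<in> Hom C m n" "k \<in> Hom C m n" "\<And>j. j \<in> J \<Longrightarrow> p (b j) \<cdot>\<^bsub>C\<^esub> h = p (b j) \<cdot>\<^bsub>C\<^esub> k" for m h k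
  proof (rule product_eqI[OF C prod that(1,2)])
    fix i assume "i \<in> I"
    then show "p i \<cdot>\<^bsub>C\<^esub> h = p i \<cdot>\<^bsub>C\<^esub> k"
      using that(3)[of "?c i"] c by simp
  qed
qed

lemma product_transport:
  assumes C: "is_category C" and prod: "is_product C I d n p"
    and u: "u \<in> Hom C m n" and v: "v \<in> Hom C n m"
    and uv: "u \<cdot>\<^bsub>C\<^esub> v = Id C n" and vu: "v \<cdot>\<^bsub>C\<^esub> u = Id C m"
  shows "is_product C I d m (\<lambda>i. p i \<cdot>\<^bsub>C\<^esub> u)"
proof (rule productI)
  have p: "p i \<in> Hom C n (d i)" if "i \<in> I" for i
    using product_Hom[OF prod that] .
  show "m \<in> Ob C" using Hom_obs[OF C u] by blast
  show "d i \<in> Ob C" "p i \<cdot>\<^bsub>C\<^esub> u \<in> Hom C m (d i)" if "i \<in> I" for i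
    using product_factor_Ob[OF prod that] Hom_comp[OF C u p[OF that]] by auto
  show "\<exists>h. h \<in> Hom C k m \<and> (\<forall>i\<in>I. p i \<cdot>\<^bsub>C\<^esub> u \<cdot>\<^bsub>C\<^esub> h = q i)"
    if kq: "k \<in> Ob C" "\<And>i. i \<in> I \<Longrightarrow> q i \<in> Hom C k (d i)" for k q
  proof -
    obtain h where h: "h \<in> Hom C k n" "\<And>i. i \<in> I \<Longrightarrow> p i \<cdot>\<^bsub>C\<^esub> h = q i"
      using product_ex[OF prod kq] by blast
    have vh: "v \<cdot>\<^bsub>C\<^esub> h \<in> Hom C k m"
      using Hom_comp[OF C h(1) v] .
    have "u \<cdot>\<^bsub>C\<^esub> (v \<cdot>\<^bsub>C\<^esub> h) = h"
      using comp_assoc[OF C h(1) v u] comp_id[OF C h(1)] uv by simp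
    then have "p i \<cdot>\<^bsub>C\<^esub> u \<cdot>\<^bsub>C\<^esub> (v \<cdot>\<^bsub>C\<^esub> h) = q i" if "i \<in> I" for i
      using comp_assoc[OF C vh u p[OF that]] h(2)[OF that] by simp
    then show ?thesis using vh by blast
  qed
  show "h = h'"
    if h: "h \<in> Hom C k m" "h' \<in> Hom C k m" and eq: "\<And>i. i \<in> I \<Longrightarrow> p i \<cdot>\<^bsub>C\<^esub> u \<cdot>\<^bsub>C\<^esub> h = p i \<cdot>\<^bsub>C\<^esub> u \<cdot>\<^bsub>C\<^esub> h'"
    for k h h'
  proof -
    have "u \<cdot>\<^bsub>C\<^esub> h = u \<cdot>\<^bsub>C\<^esub> h'"
    proof (rule product_eqI[OF C prod Hom_comp[OF C h(1) u] Hom_comp[OF C h(2) u]])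
      fix i assume i: "i \<in> I"
      show "p i \<cdot>\<^bsub>C\<^esub> (u \<cdot>\<^bsub>C\<^esub> h) = p i \<cdot>\<^bsub>C\<^esub> (u \<cdot>\<^bsub>C\<^esub> h')"
        unfolding comp_assoc[OF C h(1) u p[OF i]] comp_assoc[OF C h(2) u p[OF i]] by (rule eq[OF i])
    qed
    then have "v \<cdot>\<^bsub>C\<^esub> u \<cdot>\<^bsub>C\<^esub> h = v \<cdot>\<^bsub>C\<^esub> u \<cdot>\<^bsub>C\<^esub> h'"
      unfolding comp_assoc[OF C h(1) u v, symmetric] comp_assoc[OF C h(2) u v, symmetric] by simp
    then show ?thesis
      unfolding vu comp_id[OF C h(1)] comp_id[OF C h(2)] .
  qed
qed

lemma products_isomorphic:
  assumes C: "is_category C" and n: "is_product C I d n p" and m: "is_product C I d m q"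
  obtains u v where "u \<in> Hom C m n" "v \<in> Hom C n m"
    "u \<cdot>\<^bsub>C\<^esub> v = Id C n" "v \<cdot>\<^bsub>C\<^esub> u = Id C m" "\<And>i. i \<in> I \<Longrightarrow> p i \<cdot>\<^bsub>C\<^esub> u = q i"
proof -
  note p = product_Hom[OF n] and q = product_Hom[OF m]
  obtain u where u: "u \<in> Hom C m n" "\<And>i. i \<in> I \<Longrightarrow> p i \<cdot>\<^bsub>C\<^esub> u = q i"
    using product_ex[OF n product_Ob[OF m], of q] q by blast
  obtain v where v: "v \<in> Hom C n m" "\<And>i. i \<in> I \<Longrightarrow> q i \<cdot>\<^bsub>C\<^esub> v = p i"
    using product_ex[OF m product_Ob[OF n], of p] p by blast
  have "u \<cdot>\<^bsub>C\<^esub> v = Id C n"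
  proof (rule product_eqI[OF C n Hom_comp[OF C v(1) u(1)] Hom_id[OF C product_Ob[OF n]]])
    fix i assume i: "i \<in> I"
    show "p i \<cdot>\<^bsub>C\<^esub> (u \<cdot>\<^bsub>C\<^esub> v) = p i \<cdot>\<^bsub>C\<^esub> Id C n"
      unfolding comp_assoc[OF C v(1) u(1) p[OF i]] u(2)[OF i] v(2)[OF i] comp_id[OF C p[OF i]] ..
  qed
  moreover have "v \<cdot>\<^bsub>C\<^esub> u = Id C m"
  proof (rule product_eqI[OF C m Hom_comp[OF C u(1) v(1)] Hom_id[OF C product_Ob[OF m]]])
    fix i assume i: "i \<in> I"
    show "q i \<cdot>\<^bsub>C\<^esub> (v \<cdot>\<^bsub>C\<^esub> u) = q i \<cdot>\<^bsub>C\<^esub> Id C m"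
      unfolding comp_assoc[OF C u(1) v(1) q[OF i]] u(2)[OF i] v(2)[OF i] comp_id[OF C q[OF i]] ..
  qed
  ultimately show thesis
    using that u v by blast
qed

lemma product_Sigma:
  assumes C: "is_category C" and n: "is_product C I d n p"
    and r: "\<And>i. i \<in> I \<Longrightarrow> is_product C (J i) (c i) (d i) (r i)"
  shows "is_product C (SIGMA i:I. J i) (\<lambda>(i, j). c i j) n (\<lambda>(i, j). r i j \<cdot>\<^bsub>C\<^esub> p i)"
proof (rule productI)
  note pH = product_Hom[OF n] and rH = product_Hom[OF r]
  show "n \<in> Ob C" using product_Ob[OF n] .
  show "(case x of (i, j) \<Rightarrow> c i j) \<in> Ob C"
    "(case x of (i, j) \<Rightarrow> r i j \<cdot>\<^bsub>C\<^esub> p i) \<in> Hom C n (case x of (i, j) \<Rightarrow> c i j)"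
    if "x \<in> (SIGMA i:I. J i)" for x
    using that product_factor_Ob[OF r] Hom_comp[OF C pH rH] by auto
  show "\<exists>h. h \<in> Hom C m n \<and> (\<forall>x\<in>SIGMA i:I. J i. (case x of (i, j) \<Rightarrow> r i j \<cdot>\<^bsub>C\<^esub> p i) \<cdot>\<^bsub>C\<^esub> h = q x)"
    if m: "m \<in> Ob C" and q: "\<And>x. x \<in> (SIGMA i:I. J i) \<Longrightarrow> q x \<in> Hom C m (case x of (i, j) \<Rightarrow> c i j)" for m q
  proof -
    have "\<exists>g. g \<in> Hom C m (d i) \<and> (\<forall>j \<in> J i. r i j \<cdot>\<^bsub>C\<^esub> g = q (i, j))" if "i \<in> I" for i
    proof -
      have "q (i, j) \<in> Hom C m (c i j)" if "j \<in> J i" for j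
        using q[of "(i, j)"] that \<open>i \<in> I\<close> by simp
      then show ?thesis
        by (rule product_ex[OF r[OF \<open>i \<in> I\<close>] m, of "\<lambda>j. q (i, j)"]) blast+
    qed
    then obtain g where g: "\<And>i. i \<in> I \<Longrightarrow> g i \<in> Hom C m (d i)"
      "\<And>i j. i \<in> I \<Longrightarrow> j \<in> J i \<Longrightarrow> r i j \<cdot>\<^bsub>C\<^esub> g i = q (i, j)"
      by metis
    obtain h where h: "h \<in> Hom C m n" "\<And>i. i \<in> I \<Longrightarrow> p i \<cdot>\<^bsub>C\<^esub> h = g i"
      using product_ex[OF n m g(1)] by blast
    then show ?thesis
      using g by (intro exI[of _ h]) (auto simp: comp_assoc[OF C h(1) pH rH, symmetric])
  qed
  show "h = k"
    if hk: "h \<in> Hom C m n" "k \<in> Hom C m n"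
      and eq: "\<And>x. x \<in> (SIGMA i:I. J i) \<Longrightarrow>
        (case x of (i, j) \<Rightarrow> r i j \<cdot>\<^bsub>C\<^esub> p i) \<cdot>\<^bsub>C\<^esub> h = (case x of (i, j) \<Rightarrow> r i j \<cdot>\<^bsub>C\<^esub> p i) \<cdot>\<^bsub>C\<^esub> k"
    for m h k
  proof (rule product_eqI[OF C n hk])
    fix i assume i: "i \<in> I"
    show "p i \<cdot>\<^bsub>C\<^esub> h = p i \<cdot>\<^bsub>C\<^esub> k"
    proof (rule product_eqI[OF C r[OF i] Hom_comp[OF C hk(1) pH[OF i]] Hom_comp[OF C hk(2) pH[OF i]]])
      fix j assume j: "j \<in> J i"
      show "r i j \<cdot>\<^bsub>C\<^esub> (p i \<cdot>\<^bsub>C\<^esub> h) = r i j \<cdot>\<^bsub>C\<^esub> (p i \<cdot>\<^bsub>C\<^esub> k)"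
        using eq[of "(i, j)"] i j
        unfolding comp_assoc[OF C hk(1) pH[OF i] rH[OF i j]] comp_assoc[OF C hk(2) pH[OF i] rH[OF i j]]
        by simp
    qed
  qed
qed

text \<open>
  Together with \<open>product_Sigma\<close> this says that, once the factors \<open>d i\<close> are known to be products,
  being a product of the \<open>d i\<close> can be decided on the composite projections.
\<close>

lemma product_Sigma_cancel:
  assumes C: "is_category C" and p: "\<And>i. i \<in> I \<Longrightarrow> p i \<in> Hom C n (d i)"
    and r: "\<And>i. i \<in> I \<Longrightarrow> is_product C (J i) (c i) (d i) (r i)"
    and n: "is_product C (SIGMA i:I. J i) (\<lambda>(i, j). c i j) n (\<lambda>(i, j). r i j \<cdot>\<^bsub>C\<^esub> p i)"
  shows "is_product C I d n p"
proof (rule productI)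
  note rH = product_Hom[OF r]
  show "n \<in> Ob C" using product_Ob[OF n] .
  show "d i \<in> Ob C" "p i \<in> Hom C n (d i)" if "i \<in> I" for i
    using product_Ob[OF r[OF that]] p[OF that] by auto
  show "\<exists>h. h \<in> Hom C m n \<and> (\<forall>i\<in>I. p i \<cdot>\<^bsub>C\<^esub> h = q i)"
    if m: "m \<in> Ob C" and q: "\<And>i. i \<in> I \<Longrightarrow> q i \<in> Hom C m (d i)" for m q
  proof -
    have "(case x of (i, j) \<Rightarrow> r i j \<cdot>\<^bsub>C\<^esub> q i) \<in> Hom C m (case x of (i, j) \<Rightarrow> c i j)"
      if "x \<in> (SIGMA i:I. J i)" for x
      using that Hom_comp[OF C q rH] by auto
    from product_ex[OF n m this] obtain h where h: "h \<in> Hom C m n"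
      "\<And>x. x \<in> (SIGMA i:I. J i) \<Longrightarrow>
         (case x of (i, j) \<Rightarrow> r i j \<cdot>\<^bsub>C\<^esub> p i) \<cdot>\<^bsub>C\<^esub> h = (case x of (i, j) \<Rightarrow> r i j \<cdot>\<^bsub>C\<^esub> q i)"
      by blast
    have "p i \<cdot>\<^bsub>C\<^esub> h = q i" if i: "i \<in> I" for i
    proof (rule product_eqI[OF C r[OF i] Hom_comp[OF C h(1) p[OF i]] q[OF i]])
      fix j assume j: "j \<in> J i"
      show "r i j \<cdot>\<^bsub>C\<^esub> (p i \<cdot>\<^bsub>C\<^esub> h) = r i j \<cdot>\<^bsub>C\<^esub> q i"
        using h(2)[of "(i, j)"] comp_assoc[OF C h(1) p[OF i] rH[OF i j]] i j by simp
    qed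
    then show ?thesis using h(1) by blast
  qed
  show "h = k"
    if hk: "h \<in> Hom C m n" "k \<in> Hom C m n" and eq: "\<And>i. i \<in> I \<Longrightarrow> p i \<cdot>\<^bsub>C\<^esub> h = p i \<cdot>\<^bsub>C\<^esub> k" for m h k
  proof (rule product_eqI[OF C n hk])
    fix x assume "x \<in> (SIGMA i:I. J i)"
    then show "(case x of (i, j) \<Rightarrow> r i j \<cdot>\<^bsub>C\<^esub> p i) \<cdot>\<^bsub>C\<^esub> h = (case x of (i, j) \<Rightarrow> r i j \<cdot>\<^bsub>C\<^esub> p i) \<cdot>\<^bsub>C\<^esub> k"
      using eq by (auto simp: comp_assoc[OF C hk(1) p rH, symmetric] comp_assoc[OF C hk(2) p rH, symmetric])
  qed
qed

section \<open>Theory morphisms preserve small products\<close>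

lemma theory_category: "algebraic_theory T \<Longrightarrow> is_category T"
  and theory_Ob: "algebraic_theory T \<Longrightarrow> Ob T = cardinals"
  unfolding algebraic_theory_def by auto

lemma theory_power:
  assumes "algebraic_theory T" "n \<in> cardinals"
  obtains p where "is_product T (below n) (\<lambda>_. cardinal_one) n p"
  using assms unfolding algebraic_theory_def by blast

lemma product_cong:
  assumes "is_product C I d n p" "\<And>i. i \<in> I \<Longrightarrow> p i = p' i"
  shows "is_product C I d n p'"
  using assms unfolding is_product_def by (simp cong: ball_cong)

lemma small_Sigma:
  fixes I :: "'u set" and J :: "'u \<Rightarrow> 'u set"
  assumes inf: "infinite (UNIV :: 'u set)" and reg: "regularCard |UNIV :: 'u set|"
    and "small I" and "\<And>i. i \<in> I \<Longrightarrow> small (J i)"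
  shows "|SIGMA i:I. J i| <o |UNIV :: 'u set|"
proof -
  have "stable |UNIV :: 'u set|"
    by (rule regularCard_stable) (simp_all add: inf reg Field_card_of card_of_card_order_on)
  then show ?thesis
    using assms(3,4) unfolding small_def by (rule stable_elim)
qed

text \<open>
  The factors \<open>d i\<close> are powers of \<open>1\<close>, so \<open>n\<close> is a power of \<open>1\<close> with exponent the disjoint union of
  the \<open>below (d i)\<close>. This union is small by regularity, hence \<open>n\<close> is isomorphic to the object \<open>m\<close>
  that is the cardinal of the union, although \<open>n\<close> and \<open>m\<close> may differ. The chosen power \<open>m\<close> is
  preserved by hypothesis; this carries over to \<open>n\<close> along the isomorphism, and
  \<open>product_Sigma_cancel\<close> undoes the decomposition on the side of \<open>T\<close>.
\<close>

lemma theory_morphism_product: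
  fixes S :: "('u, 's) category" and T :: "('u, 't) category" and I :: "'u set"
  assumes inf: "infinite (UNIV :: 'u set)" and reg: "regularCard |UNIV :: 'u set|"
    and thS: "algebraic_theory S" and thT: "algebraic_theory T" and K: "theory_morphism S T K"
    and I: "small I" and n: "is_product S I d n p"
  shows "is_product T I (\<lambda>i. omap K (d i)) (omap K n) (\<lambda>i. amap K (p i))"
proof -
  note S = theory_category[OF thS] and T = theory_category[OF thT]
  have F: "is_functor S T K"
    and pres: "\<And>n p. n \<in> cardinals \<Longrightarrow> is_product S (below n) (\<lambda>_. cardinal_one) n p \<Longrightarrow>
         is_product T (below n) (\<lambda>_. cardinal_one) n (\<lambda>i. amap K (p i))"
    and Kn: "\<And>n. n \<in> cardinals \<Longrightarrow> omap K n = n"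
    using K unfolding theory_morphism_def by auto
  have d: "d i \<in> cardinals" if "i \<in> I" for i
    using product_factor_Ob[OF n that] theory_Ob[OF thS] by simp
  have "\<exists>r. is_product S (below (d i)) (\<lambda>_. cardinal_one) (d i) r" if "i \<in> I" for i
    using theory_power[OF thS d[OF that]] by blast
  then obtain r where r: "\<And>i. i \<in> I \<Longrightarrow> is_product S (below (d i)) (\<lambda>_. cardinal_one) (d i) (r i)"
    by metis
  let ?J = "SIGMA i:I. below (d i)"
  have one: "(\<lambda>x. case x of (i, j) \<Rightarrow> cardinal_one) = (\<lambda>_. cardinal_one :: 'u)"
    by (simp add: fun_eq_iff split: prod.split)
  have "is_product S ?J (\<lambda>(i, j). cardinal_one) n (\<lambda>(i, j). r i j \<cdot>\<^bsub>S\<^esub> p i)"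
    by (rule product_Sigma[OF S n r])
  then have SJ: "is_product S ?J (\<lambda>_. cardinal_one) n (\<lambda>(i, j). r i j \<cdot>\<^bsub>S\<^esub> p i)"
    unfolding one .
  obtain m :: 'u and b where m: "m \<in> cardinals" and b: "bij_betw b (below m) ?J"
    using equipotent_cardinal[OF small_Sigma[OF inf reg I small_below]] by blast
  obtain p' where p': "is_product S (below m) (\<lambda>_. cardinal_one) m p'"
    using theory_power[OF thS m] .
  have SJ': "is_product S (below m) (\<lambda>_. cardinal_one) n (\<lambda>k. case b k of (i, j) \<Rightarrow> r i j \<cdot>\<^bsub>S\<^esub> p i)"
    by (rule product_reindex[OF S SJ b])
  obtain u v where u: "u \<in> Hom S n m" and v: "v \<in> Hom S m n"
    and uv: "u \<cdot>\<^bsub>S\<^esub> v = Id S m" "v \<cdot>\<^bsub>S\<^esub> u = Id S n"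
    and p'u: "\<And>k. k \<in> below m \<Longrightarrow> p' k \<cdot>\<^bsub>S\<^esub> u = (case b k of (i, j) \<Rightarrow> r i j \<cdot>\<^bsub>S\<^esub> p i)"
    using products_isomorphic[OF S p' SJ'] by blast
  have Kid: "amap K (Id S a) = Id T (omap K a)" if "a \<in> Ob S" for a
    using F that unfolding is_functor_def by blast
  have Ku: "amap K u \<in> Hom T (omap K n) m" and Kv: "amap K v \<in> Hom T m (omap K n)"
    using functor_Hom[OF S F u] functor_Hom[OF S F v] Kn[OF m] by simp_all
  have Kuv: "amap K u \<cdot>\<^bsub>T\<^esub> amap K v = Id T m" "amap K v \<cdot>\<^bsub>T\<^esub> amap K u = Id T (omap K n)"
    using functor_comp[OF S F v u] functor_comp[OF S F u v] uv Kid Hom_obs[OF S u] Kn[OF m]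
    by simp_all
  have "is_product T (below m) (\<lambda>_. cardinal_one) (omap K n) (\<lambda>k. amap K (p' k) \<cdot>\<^bsub>T\<^esub> amap K u)"
    by (rule product_transport[OF T pres[OF m p'] Ku Kv Kuv])
  from product_reindex[OF T this bij_betw_inv_into[OF b]]
  have TJ: "is_product T ?J (\<lambda>_. cardinal_one) (omap K n)
      (\<lambda>x. amap K (p' (inv_into (below m) b x)) \<cdot>\<^bsub>T\<^esub> amap K u)" .
  have Kr: "is_product T (below (d i)) (\<lambda>_. cardinal_one) (omap K (d i)) (\<lambda>j. amap K (r i j))"
    if "i \<in> I" for i
    using pres[OF d[OF that] r[OF that]] Kn[OF d[OF that]] by simp
  have legs: "amap K (p' (inv_into (below m) b x)) \<cdot>\<^bsub>T\<^esub> amap K u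
      = (case x of (i, j) \<Rightarrow> amap K (r i j) \<cdot>\<^bsub>T\<^esub> amap K (p i))" if x: "x \<in> ?J" for x
  proof -
    obtain i j where ij: "x = (i, j)" "i \<in> I" "j \<in> below (d i)"
      using x by blast
    let ?k = "inv_into (below m) b x"
    have k: "?k \<in> below m" "b ?k = x"
      using b x by (auto simp: bij_betw_def inv_into_into f_inv_into_f)
    have "amap K (p' ?k) \<cdot>\<^bsub>T\<^esub> amap K u = amap K (p' ?k \<cdot>\<^bsub>S\<^esub> u)"
      using functor_comp[OF S F u product_Hom[OF p' k(1)]] by simp
    also have "\<dots> = amap K (r i j \<cdot>\<^bsub>S\<^esub> p i)"
      using p'u[OF k(1)] k(2) ij(1) by simp
    also have "\<dots> = amap K (r i j) \<cdot>\<^bsub>T\<^esub> amap K (p i)"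
      using functor_comp[OF S F product_Hom[OF n ij(2)] product_Hom[OF r[OF ij(2)] ij(3)]] .
    finally show ?thesis
      by (simp add: ij(1))
  qed
  have "is_product T ?J (\<lambda>(i, j). cardinal_one) (omap K n) (\<lambda>(i, j). amap K (r i j) \<cdot>\<^bsub>T\<^esub> amap K (p i))"
    using product_cong[OF TJ] legs unfolding one by blast
  then show ?thesis
    by (intro product_Sigma_cancel[where p = "\<lambda>i. amap K (p i)" and r = "\<lambda>i j. amap K (r i j)"
          and J = "\<lambda>i. below (d i)" and c = "\<lambda>i j. cardinal_one"]
        T Kr functor_Hom[OF S F product_Hom[OF n]])
qed

section \<open>Products of preordered sets\<close>

lemma Preorder_refl: "Preorder r \<Longrightarrow> x \<in> Field r \<Longrightarrow> (x, x) \<in> r"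
  unfolding preorder_on_def refl_on_def by blast

lemma Preorder_trans: "Preorder r \<Longrightarrow> (x, y) \<in> r \<Longrightarrow> (y, z) \<in> r \<Longrightarrow> (x, z) \<in> r"
  unfolding preorder_on_def by (blast dest: transD)

lemma PreorderI:
  assumes "\<And>x y. (x, y) \<in> r \<Longrightarrow> (x, x) \<in> r \<and> (y, y) \<in> r"
    and "\<And>x y z. (x, y) \<in> r \<Longrightarrow> (y, z) \<in> r \<Longrightarrow> (x, z) \<in> r"
  shows "Preorder r"
proof -
  have "r \<subseteq> Field r \<times> Field r"
    by (auto simp: FieldI1 FieldI2)
  moreover have "refl_on (Field r) r"
    using assms(1) by (auto simp: refl_on_def Field_def)
  ultimately show ?thesis
    using assms(2) by (simp add: preorder_on_def transI)
qed

text \<open>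
  The order-theoretic content of being a product: up to isomorphism \<open>r\<close> is the set of tuples of
  the \<open>d i\<close> with the componentwise order. This reading presupposes that the
  maps \<open>p i\<close> are monotone.
\<close>

definition cartesian :: "'i set \<Rightarrow> ('i \<Rightarrow> 'u rel) \<Rightarrow> 'u rel \<Rightarrow> ('i \<Rightarrow> 'u \<Rightarrow> 'u) \<Rightarrow> bool" where
  "cartesian I d r p \<longleftrightarrow>
     (\<forall>x \<in> Field r. \<forall>y \<in> Field r. (\<forall>i \<in> I. (p i x, p i y) \<in> d i) \<longrightarrow> (x, y) \<in> r) \<and>
     (\<forall>x \<in> Field r. \<forall>y \<in> Field r. (\<forall>i \<in> I. p i x = p i y) \<longrightarrow> x = y) \<and>
     (\<forall>z. (\<forall>i \<in> I. z i \<in> Field (d i)) \<longrightarrow> (\<exists>x \<in> Field r. \<forall>i \<in> I. p i x = z i))"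

lemma cartesian_le:
  "cartesian I d r p \<Longrightarrow> x \<in> Field r \<Longrightarrow> y \<in> Field r \<Longrightarrow> (\<And>i. i \<in> I \<Longrightarrow> (p i x, p i y) \<in> d i) \<Longrightarrow> (x, y) \<in> r"
  unfolding cartesian_def by blast

lemma cartesian_eq:
  "cartesian I d r p \<Longrightarrow> x \<in> Field r \<Longrightarrow> y \<in> Field r \<Longrightarrow> (\<And>i. i \<in> I \<Longrightarrow> p i x = p i y) \<Longrightarrow> x = y"
  unfolding cartesian_def by blast

lemma cartesian_tuple:
  assumes "cartesian I d r p" "\<And>i. i \<in> I \<Longrightarrow> z i \<in> Field (d i)"
  obtains x where "x \<in> Field r" "\<And>i. i \<in> I \<Longrightarrow> p i x = z i"
  using assms unfolding cartesian_def by blast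

lemma monotone_Hom_iff:
  "f \<in> Hom (monotone_category \<O>) r s \<longleftrightarrow>
     r \<in> \<O> \<and> s \<in> \<O> \<and> src f = r \<and> tgt f = s \<and> content f \<in> Field r \<rightarrow>\<^sub>E Field s \<and>
     (\<forall>x y. (x, y) \<in> r \<longrightarrow> (content f x, content f y) \<in> s)"
  by (cases f) (auto simp: Hom_def monotone_category_def)

lemma monotone_HomI:
  assumes "r \<in> \<O>" "s \<in> \<O>" "\<And>x. x \<in> Field r \<Longrightarrow> g x \<in> Field s"
    and "\<And>x y. (x, y) \<in> r \<Longrightarrow> (g x, g y) \<in> s"
  shows "Arrow r s (restrict g (Field r)) \<in> Hom (monotone_category \<O>) r s"
  unfolding monotone_Hom_iff using assms by (auto simp: FieldI1 FieldI2)

lemma monotone_HomD: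
  assumes "f \<in> Hom (monotone_category \<O>) r s"
  shows "x \<in> Field r \<Longrightarrow> content f x \<in> Field s"
    and "(x, y) \<in> r \<Longrightarrow> (content f x, content f y) \<in> s"
  using assms unfolding monotone_Hom_iff by auto

lemma monotone_Hom_eqI:
  assumes f: "f \<in> Hom (monotone_category \<O>) r s" and g: "g \<in> Hom (monotone_category \<O>) r s"
    and eq: "\<And>x. x \<in> Field r \<Longrightarrow> content f x = content g x"
  shows "f = g"
proof (rule arrow.expand)
  have "content f = content g"
    by (rule PiE_ext[of _ "Field r" "\<lambda>_. Field s"]) (use f g in \<open>simp_all add: monotone_Hom_iff eq\<close>)
  then show "src f = src g \<and> tgt f = tgt g \<and> content f = content g"
    using f g unfolding monotone_Hom_iff by simp
qed

lemma monotone_comp: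
  "x \<in> Field (src f) \<Longrightarrow> content (g \<cdot>\<^bsub>monotone_category \<O>\<^esub> f) x = content g (content f x)"
  "src (g \<cdot>\<^bsub>monotone_category \<O>\<^esub> f) = src f" "tgt (g \<cdot>\<^bsub>monotone_category \<O>\<^esub> f) = tgt g"
  by (simp_all add: monotone_category_def compose_def)

lemma monotone_Hom_comp:
  assumes "f \<in> Hom (monotone_category \<O>) r s" "g \<in> Hom (monotone_category \<O>) s t"
  shows "g \<cdot>\<^bsub>monotone_category \<O>\<^esub> f \<in> Hom (monotone_category \<O>) r t"
proof -
  have "g \<cdot>\<^bsub>monotone_category \<O>\<^esub> f = Arrow r t (restrict (\<lambda>x. content g (content f x)) (Field r))"
    using assms unfolding monotone_Hom_iff by (simp add: monotone_category_def compose_def)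
  moreover have "r \<in> \<O>" "t \<in> \<O>"
    using assms unfolding monotone_Hom_iff by auto
  ultimately show ?thesis
    using monotone_HomD[OF assms(1)] monotone_HomD[OF assms(2)] by (simp add: monotone_HomI)
qed

lemma monotone_Id: "Id (monotone_category \<O>) r = Arrow r r (restrict (\<lambda>x. x) (Field r))"
  by (simp add: monotone_category_def)

lemma monotone_Hom_id: "r \<in> \<O> \<Longrightarrow> Id (monotone_category \<O>) r \<in> Hom (monotone_category \<O>) r r"
  unfolding monotone_Id by (rule monotone_HomI)

lemma monotone_Ob: "Ob (monotone_category \<O>) = \<O>"
  by (simp add: monotone_category_def)

lemma monotone_src: "f \<in> Hom (monotone_category \<O>) r s \<Longrightarrow> src f = r"
  and monotone_tgt: "f \<in> Hom (monotone_category \<O>) r s \<Longrightarrow> tgt f = s"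
  unfolding monotone_Hom_iff by auto

lemma monotone_is_category: "is_category (monotone_category \<O>)"
  unfolding is_category_def
proof (intro conjI ballI)
  let ?V = "monotone_category \<O>"
  show "Dom ?V f \<in> Ob ?V" "Cod ?V f \<in> Ob ?V" if "f \<in> Arr ?V" for f
    using that by (auto simp: monotone_category_def)
  show "Id ?V r \<in> Hom ?V r r" if "r \<in> Ob ?V" for r
    using that by (simp add: monotone_Ob monotone_Hom_id)
  show "g \<cdot>\<^bsub>?V\<^esub> f \<in> Hom ?V r t" if "f \<in> Hom ?V r s" "g \<in> Hom ?V s t" for f g r s t
    using that by (rule monotone_Hom_comp)
  show "f \<cdot>\<^bsub>?V\<^esub> Id ?V r = f" "Id ?V s \<cdot>\<^bsub>?V\<^esub> f = f"
    if rs: "r \<in> Ob ?V" "s \<in> Ob ?V" and f: "f \<in> Hom ?V r s" for f r s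
  proof -
    note r = monotone_Hom_id[OF rs(1)[unfolded monotone_Ob]] and s = monotone_Hom_id[OF rs(2)[unfolded monotone_Ob]]
    show "f \<cdot>\<^bsub>?V\<^esub> Id ?V r = f"
      by (rule monotone_Hom_eqI[OF monotone_Hom_comp[OF r f] f]) (simp add: monotone_comp monotone_Id)
    show "Id ?V s \<cdot>\<^bsub>?V\<^esub> f = f"
      by (rule monotone_Hom_eqI[OF monotone_Hom_comp[OF f s] f])
        (simp add: monotone_comp monotone_Id monotone_src[OF f] monotone_HomD[OF f])
  qed
  show "h \<cdot>\<^bsub>?V\<^esub> (g \<cdot>\<^bsub>?V\<^esub> f) = h \<cdot>\<^bsub>?V\<^esub> g \<cdot>\<^bsub>?V\<^esub> f"
    if f: "f \<in> Hom ?V r s" and g: "g \<in> Hom ?V s t" and h: "h \<in> Hom ?V t w" for f g h r s t w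
    by (rule monotone_Hom_eqI[OF monotone_Hom_comp[OF monotone_Hom_comp[OF f g] h]
          monotone_Hom_comp[OF f monotone_Hom_comp[OF g h]]])
      (simp add: monotone_comp monotone_src[OF f] monotone_src[OF g] monotone_HomD[OF f])
qed

lemma monotone_Le: "Le (monotone_category \<O>) f g \<longleftrightarrow> (\<forall>x \<in> Field (src f). (content f x, content g x) \<in> tgt f)"
  by (simp add: monotone_category_def)

text \<open>
  What preorders and partial orders have in common here. The last assumption says that a small
  preorder belongs to the class as soon as any two distinct equivalent points are
  distinguished by a monotone map into a member. A monotone map into a poset identifies
  equivalent points, so in the class of posets this condition leaves only the antisymmetric
  preorders. On small posets the condition is void: they belong to every such class.
\<close>

locale separating_class =
  fixes \<O> :: "'u rel set"
  assumes infinite_universe: "infinite (UNIV :: 'u set)"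
    and small_preorder: "r \<in> \<O> \<Longrightarrow> Preorder r \<and> small (Field r)"
    and separated: "\<lbrakk>Preorder r; small (Field r);
        \<And>x y. \<lbrakk>(x, y) \<in> r; (y, x) \<in> r; x \<noteq> y\<rbrakk> \<Longrightarrow>
          \<exists>s g. s \<in> \<O> \<and> (\<forall>u v. (u, v) \<in> r \<longrightarrow> (g u, g v) \<in> s) \<and> g x \<noteq> g y\<rbrakk> \<Longrightarrow> r \<in> \<O>"
begin

abbreviation V :: "('u rel, ('u rel, 'u \<Rightarrow> 'u) arrow) ocategory" where
  "V \<equiv> monotone_category \<O>"

lemma chain_in:
  "{(a, a), (b, b), (a, b)} \<in> \<O>"
proof (rule separated)
  show "Preorder {(a, a), (b, b), (a, b)}"
    by (rule PreorderI) auto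
  show "small (Field {(a, a), (b, b), (a, b)})"
    by (rule small_finite[OF infinite_universe]) simp
qed auto

text \<open>
  The description does not depend on the class, so that products of posets are computed as for
  preorders. A categorical product is tested against the two-element chain: monotone maps out
  of it are the pairs \<open>x \<le> y\<close>, which yields tuples, injectivity and the order at once.
\<close>

lemma product_iff_cartesian:
  "is_product V I d r p \<longleftrightarrow>
     r \<in> \<O> \<and> (\<forall>i \<in> I. d i \<in> \<O> \<and> p i \<in> Hom V r (d i)) \<and> cartesian I d r (\<lambda>i. content (p i))"
  (is "?L \<longleftrightarrow> ?R")
proof
  assume prod: ?L
  then have r: "r \<in> \<O>" and d: "\<And>i. i \<in> I \<Longrightarrow> d i \<in> \<O>" and p: "\<And>i. i \<in> I \<Longrightarrow> p i \<in> Hom V r (d i)"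
    unfolding is_product_def monotone_Ob by auto
  obtain a b :: 'u where ab: "a \<noteq> b"
    using infinite_universe by (metis finite.emptyI finite.insertI finite_subset insertI1 subsetI)
  let ?two = "{(a, a), (b, b), (a, b)}"
  have field: "Field ?two = {a, b}"
    by (auto simp: Field_def)
  \<comment> \<open>a monotone pair of compatible tuples is a map out of the chain\<close>
  have pair: "\<exists>x y. (x, y) \<in> r \<and> (\<forall>i \<in> I. content (p i) x = z i \<and> content (p i) y = w i)"
    if zw: "\<And>i. i \<in> I \<Longrightarrow> (z i, w i) \<in> d i" for z w
  proof -
    define q where "q i = Arrow ?two (d i) (restrict (\<lambda>x. if x = a then z i else w i) {a, b})" for i
    have q: "q i \<in> Hom V ?two (d i)" if "i \<in> I" for i
    proof -
      have zw': "z i \<in> Field (d i)" "w i \<in> Field (d i)"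
        using zw[OF that] by (auto simp: FieldI1 FieldI2)
      then have "(z i, z i) \<in> d i" "(w i, w i) \<in> d i"
        using small_preorder[OF d[OF that]] by (auto simp: Preorder_refl)
      then have "Arrow ?two (d i) (restrict (\<lambda>x. if x = a then z i else w i) (Field ?two)) \<in> Hom V ?two (d i)"
        using zw[OF that] zw' ab by (intro monotone_HomI chain_in d that) auto
      then show ?thesis
        unfolding field q_def .
    qed
    obtain h where h: "h \<in> Hom V ?two r" "\<And>i. i \<in> I \<Longrightarrow> p i \<cdot>\<^bsub>V\<^esub> h = q i"
      using product_ex[OF prod, of ?two q] q chain_in unfolding monotone_Ob by blast
    have src: "src h = ?two"
      using h(1) unfolding monotone_Hom_iff by blast
    have "content (p i) (content h x) = content (q i) x" if "i \<in> I" "x \<in> {a, b}" for i x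
      using h(2)[OF that(1)] monotone_comp(1)[of x h \<O> "p i"] that(2) src field by auto
    then have "\<forall>i \<in> I. content (p i) (content h a) = z i \<and> content (p i) (content h b) = w i"
      using ab by (simp add: q_def)
    moreover have "(content h a, content h b) \<in> r"
      using monotone_HomD(2)[OF h(1), of a b] by simp
    ultimately show ?thesis by blast
  qed
  have inj: "x = y" if xy: "x \<in> Field r" "y \<in> Field r" "\<forall>i \<in> I. content (p i) x = content (p i) y" for x y
  proof -
    let ?k = "\<lambda>x. Arrow ?two r (restrict (\<lambda>_. x) {a, b})"
    have k: "?k x \<in> Hom V ?two r" if "x \<in> Field r" for x
      using monotone_HomI[OF chain_in r, of a b "\<lambda>_. x"] that small_preorder[OF r]
      unfolding field by (simp add: Preorder_refl)
    have "?k x = ?k y"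
    proof (rule product_eqI[OF _ prod k[OF xy(1)] k[OF xy(2)]])
      show "p i \<cdot>\<^bsub>V\<^esub> ?k x = p i \<cdot>\<^bsub>V\<^esub> ?k y" if "i \<in> I" for i
        using xy(3) that
        by (intro monotone_Hom_eqI[OF monotone_Hom_comp[OF k[OF xy(1)] p[OF that]]
              monotone_Hom_comp[OF k[OF xy(2)] p[OF that]]])
          (auto simp: monotone_comp field)
    qed (rule monotone_is_category)
    then show ?thesis
      by (simp add: fun_eq_iff restrict_def) (metis)
  qed
  show ?R
    unfolding cartesian_def
  proof (intro conjI ballI allI impI)
    fix x y assume xy: "x \<in> Field r" "y \<in> Field r" "\<forall>i\<in>I. (content (p i) x, content (p i) y) \<in> d i"
    then obtain x' y' where "(x', y') \<in> r"
      "\<forall>i \<in> I. content (p i) x' = content (p i) x \<and> content (p i) y' = content (p i) y"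
      using pair[of "\<lambda>i. content (p i) x" "\<lambda>i. content (p i) y"] by blast
    then show "(x, y) \<in> r"
      using inj[of x' x] inj[of y' y] xy by (auto simp: FieldI1 FieldI2)
  next
    fix z assume "\<forall>i\<in>I. z i \<in> Field (d i)"
    then have "(z i, z i) \<in> d i" if "i \<in> I" for i
      using that small_preorder[OF d[OF that]] by (simp add: Preorder_refl)
    then show "\<exists>x\<in>Field r. \<forall>i\<in>I. content (p i) x = z i"
      using pair[of z z] FieldI1 by fast
  qed (use r d p inj in auto)
next
  assume R: ?R
  then have r: "r \<in> \<O>" and d: "\<And>i. i \<in> I \<Longrightarrow> d i \<in> \<O>" and p: "\<And>i. i \<in> I \<Longrightarrow> p i \<in> Hom V r (d i)"
    and cart: "cartesian I d r (\<lambda>i. content (p i))"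
    by auto
  show ?L
  proof (rule productI)
    fix m q assume m: "m \<in> Ob V" and q: "\<And>i. i \<in> I \<Longrightarrow> q i \<in> Hom V m (d i)"
    have "\<exists>y \<in> Field r. \<forall>i \<in> I. content (p i) y = content (q i) x" if "x \<in> Field m" for x
    proof -
      have "content (q i) x \<in> Field (d i)" if "i \<in> I" for i
        using monotone_HomD(1)[OF q[OF that] \<open>x \<in> Field m\<close>] .
      then show ?thesis
        by (rule cartesian_tuple[OF cart, of "\<lambda>i. content (q i) x"]) blast+
    qed
    then obtain g where g: "\<And>x. x \<in> Field m \<Longrightarrow> g x \<in> Field r"
      "\<And>x i. x \<in> Field m \<Longrightarrow> i \<in> I \<Longrightarrow> content (p i) (g x) = content (q i) x"
      by metis
    have mono: "(g x, g y) \<in> r" if "(x, y) \<in> m" for x y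
    proof (rule cartesian_le[OF cart])
      have xy: "x \<in> Field m" "y \<in> Field m"
        using that by (auto simp: FieldI1 FieldI2)
      then show "g x \<in> Field r" "g y \<in> Field r"
        using g(1) by auto
      show "(content (p i) (g x), content (p i) (g y)) \<in> d i" if "i \<in> I" for i
        using g(2)[OF xy(1) that] g(2)[OF xy(2) that] monotone_HomD(2)[OF q[OF that] \<open>(x, y) \<in> m\<close>] by simp
    qed
    let ?h = "Arrow m r (restrict g (Field m))"
    have h: "?h \<in> Hom V m r"
      using monotone_HomI[OF _ r] g(1) mono m unfolding monotone_Ob by blast
    have "p i \<cdot>\<^bsub>V\<^esub> ?h = q i" if "i \<in> I" for i
      by (rule monotone_Hom_eqI[OF monotone_Hom_comp[OF h p[OF that]] q[OF that]])
        (simp add: monotone_comp g that)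
    then show "\<exists>h. h \<in> Hom V m r \<and> (\<forall>i \<in> I. p i \<cdot>\<^bsub>V\<^esub> h = q i)"
      using h by blast
  next
    fix m h k assume h: "h \<in> Hom V m r" and k: "k \<in> Hom V m r"
      and eq: "\<And>i. i \<in> I \<Longrightarrow> p i \<cdot>\<^bsub>V\<^esub> h = p i \<cdot>\<^bsub>V\<^esub> k"
    have src: "src h = m" "src k = m"
      using h k unfolding monotone_Hom_iff by auto
    show "h = k"
    proof (rule monotone_Hom_eqI[OF h k])
      fix x assume x: "x \<in> Field m"
      have "content (p i) (content h x) = content (p i) (content k x)" if "i \<in> I" for i
        using arg_cong[OF eq[OF that], of "\<lambda>f. content f x"] x by (simp add: monotone_comp src)
      then show "content h x = content k x"
        using cartesian_eq[OF cart monotone_HomD(1)[OF h x] monotone_HomD(1)[OF k x]] by blast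
    qed
  qed (use r d p in \<open>auto simp: monotone_Ob\<close>)
qed

end

section \<open>Algebras and homomorphisms elementwise\<close>

lemma cartesian_cong:
  assumes "\<And>i. i \<in> I \<Longrightarrow> d i = d' i" "\<And>i x. i \<in> I \<Longrightarrow> x \<in> Field r \<Longrightarrow> p i x = p' i x"
  shows "cartesian I d r p \<longleftrightarrow> cartesian I d' r p'"
  unfolding cartesian_def using assms by (simp cong: ball_cong conj_cong imp_cong bex_cong)

definition action :: "('u, 't) algebra \<Rightarrow> 't \<Rightarrow> 'u \<Rightarrow> 'u" where
  "action A f = content (amap A f)"

definition component :: "('u, 't) hom \<Rightarrow> 'u \<Rightarrow> 'u \<Rightarrow> 'u" where
  "component \<tau> n = content (content \<tau> n)"

text \<open>
  Elementwise data are turned into algebras and homomorphisms by restricting all maps to their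
  domains, as extensionality demands.
\<close>

definition make_algebra :: "('u, 't) category \<Rightarrow> ('u \<Rightarrow> 'u rel) \<Rightarrow> ('t \<Rightarrow> 'u \<Rightarrow> 'u) \<Rightarrow> ('u, 't) algebra" where
  "make_algebra T R a =
     \<lparr> omap = (\<lambda>n \<in> Ob T. R n),
       amap = (\<lambda>f \<in> Arr T. Arrow (R (Dom T f)) (R (Cod T f)) (restrict (a f) (Field (R (Dom T f))))) \<rparr>"

definition make_hom :: "('u, 't) category \<Rightarrow> ('u, 't) algebra \<Rightarrow> ('u, 't) algebra \<Rightarrow> ('u \<Rightarrow> 'u \<Rightarrow> 'u) \<Rightarrow> ('u, 't) hom" where
  "make_hom T A B h =
     Arrow A B (\<lambda>n \<in> Ob T. Arrow (omap A n) (omap B n) (restrict (h n) (Field (omap A n))))"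

lemma make_algebra_simps:
  "n \<in> Ob T \<Longrightarrow> omap (make_algebra T R a) n = R n"
  "f \<in> Hom T m n \<Longrightarrow> amap (make_algebra T R a) f = Arrow (R m) (R n) (restrict (a f) (Field (R m)))"
  "f \<in> Hom T m n \<Longrightarrow> x \<in> Field (R m) \<Longrightarrow> action (make_algebra T R a) f x = a f x"
  by (auto simp: make_algebra_def Hom_def action_def)

lemma component_make_hom:
  "n \<in> Ob T \<Longrightarrow> x \<in> Field (omap A n) \<Longrightarrow> component (make_hom T A B h) n x = h n x"
  by (simp add: make_hom_def component_def)

lemma Alg_Hom_iff:
  "\<tau> \<in> Hom (Alg T W) A B \<longleftrightarrow>
     A \<in> algebras T W \<and> B \<in> algebras T W \<and> src \<tau> = A \<and> tgt \<tau> = B \<and> content \<tau> \<in> extensional (Ob T) \<and>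
     (\<forall>n \<in> Ob T. content \<tau> n \<in> Hom W (omap A n) (omap B n)) \<and>
     (\<forall>m \<in> Ob T. \<forall>n \<in> Ob T. \<forall>f \<in> Hom T m n. content \<tau> n \<cdot>\<^bsub>W\<^esub> amap A f = amap B f \<cdot>\<^bsub>W\<^esub> content \<tau> m)"
  unfolding Hom_def[of "Alg T W"] unfolding Alg_def by (cases \<tau>) auto

lemma Alg_Ob: "Ob (Alg T W) = algebras T W"
  by (simp add: Alg_def)

locale algebras_over = separating_class \<O> for \<O> :: "'u rel set" +
  fixes T :: "('u, 't) category"
  assumes category: "is_category T"
begin

lemma algebra_Hom: "A \<in> algebras T V \<Longrightarrow> f \<in> Hom T m n \<Longrightarrow> amap A f \<in> Hom V (omap A m) (omap A n)"
  using functor_Hom[OF category] unfolding algebras_def by blast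

lemma algebra_carrier: "A \<in> algebras T V \<Longrightarrow> n \<in> Ob T \<Longrightarrow> omap A n \<in> \<O>"
  unfolding algebras_def is_functor_def monotone_Ob by blast

lemma algebra_preorder: "A \<in> algebras T V \<Longrightarrow> n \<in> Ob T \<Longrightarrow> Preorder (omap A n)"
  using algebra_carrier small_preorder by blast

lemma action_closed:
  "A \<in> algebras T V \<Longrightarrow> f \<in> Hom T m n \<Longrightarrow> x \<in> Field (omap A m) \<Longrightarrow> action A f x \<in> Field (omap A n)"
  unfolding action_def by (rule monotone_HomD(1)[OF algebra_Hom])

lemma action_mono:
  "A \<in> algebras T V \<Longrightarrow> f \<in> Hom T m n \<Longrightarrow> (x, y) \<in> omap A m \<Longrightarrow> (action A f x, action A f y) \<in> omap A n"
  unfolding action_def by (rule monotone_HomD(2)[OF algebra_Hom])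

lemma action_id: 
  assumes "A \<in> algebras T V" "n \<in> Ob T" "x \<in> Field (omap A n)"
  shows "action A (Id T n) x = x"
proof -
  have "amap A (Id T n) = Id V (omap A n)"
    using assms(1,2) unfolding algebras_def is_functor_def by blast
  then show ?thesis
    using assms(3) by (simp add: action_def monotone_Id)
qed

lemma action_comp:
  assumes A: "A \<in> algebras T V" and f: "f \<in> Hom T m n" and g: "g \<in> Hom T n k" and x: "x \<in> Field (omap A m)"
  shows "action A (g \<cdot>\<^bsub>T\<^esub> f) x = action A g (action A f x)"
proof -
  have "is_functor T V A"
    using A unfolding algebras_def by blast
  note functor_comp[OF category this f g]
  then show ?thesis
    using x by (simp add: action_def monotone_comp monotone_src[OF algebra_Hom[OF A f]])
qed

lemma algebra_cartesian:
  fixes I :: "'u set"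
  assumes "A \<in> algebras T V" "small I" "is_product T I d n p"
  shows "cartesian I (\<lambda>i. omap A (d i)) (omap A n) (\<lambda>i. action A (p i))"
proof -
  have "is_product V I (\<lambda>i. omap A (d i)) (omap A n) (\<lambda>i. amap A (p i))"
    using assms unfolding algebras_def preserves_products_def by blast
  then show ?thesis
    unfolding product_iff_cartesian action_def by blast
qed

lemma make_algebra_in:
  assumes R: "\<And>n. n \<in> Ob T \<Longrightarrow> R n \<in> \<O>"
    and closed: "\<And>f m n x. f \<in> Hom T m n \<Longrightarrow> x \<in> Field (R m) \<Longrightarrow> a f x \<in> Field (R n)"
    and mono: "\<And>f m n x y. f \<in> Hom T m n \<Longrightarrow> (x, y) \<in> R m \<Longrightarrow> (a f x, a f y) \<in> R n"
    and id: "\<And>n x. n \<in> Ob T \<Longrightarrow> x \<in> Field (R n) \<Longrightarrow> a (Id T n) x = x"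
    and comp: "\<And>f g k m n x. f \<in> Hom T k m \<Longrightarrow> g \<in> Hom T m n \<Longrightarrow> x \<in> Field (R k) \<Longrightarrow>
        a (g \<cdot>\<^bsub>T\<^esub> f) x = a g (a f x)"
    and prod: "\<And>I :: 'u set. \<And>d n p. small I \<Longrightarrow> is_product T I d n p \<Longrightarrow>
        cartesian I (\<lambda>i. R (d i)) (R n) (\<lambda>i. a (p i))"
  shows "make_algebra T R a \<in> algebras T V"
proof -
  let ?A = "make_algebra T R a"
  note simps = make_algebra_simps
  have Hom: "amap ?A f \<in> Hom V (omap ?A m) (omap ?A n)" if f: "f \<in> Hom T m n" for f m n
    using monotone_HomI[of "R m" \<O> "R n" "a f"] Hom_obs[OF category f] R closed[OF f] mono[OF f]
    by (simp add: simps(1) simps(2)[OF f])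
  have "is_functor T V ?A"
    unfolding is_functor_def monotone_Ob
  proof (intro conjI ballI)
    show "omap ?A n \<in> \<O>" if "n \<in> Ob T" for n
      using that R by (simp add: simps)
    show "amap ?A f \<in> Hom V (omap ?A m) (omap ?A n)" if "f \<in> Hom T m n" for f m n
      using that by (rule Hom)
    show "amap ?A (Id T n) = Id V (omap ?A n)" if n: "n \<in> Ob T" for n
    proof -
      have "omap ?A n \<in> \<O>" using n R by (simp add: simps)
      then show ?thesis
        using id[OF n] by (intro monotone_Hom_eqI[OF Hom[OF Hom_id[OF category n]] monotone_Hom_id])
          (simp_all add: monotone_Id simps(1)[OF n] simps(2)[OF Hom_id[OF category n]])
    qed
    show "amap ?A (g \<cdot>\<^bsub>T\<^esub> f) = amap ?A g \<cdot>\<^bsub>V\<^esub> amap ?A f"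
      if f: "f \<in> Hom T k m" and g: "g \<in> Hom T m n" for f g k m n
      using comp[OF f g] closed[OF f] Hom_obs[OF category f] Hom_comp[OF category f g]
      by (intro monotone_Hom_eqI[OF Hom[OF Hom_comp[OF category f g]] monotone_Hom_comp[OF Hom[OF f] Hom[OF g]]])
        (simp add: simps(1) monotone_comp simps(2)[OF f] simps(2)[OF g] simps(2)[OF Hom_comp[OF category f g]])
  qed
  moreover have "preserves_products T V ?A TYPE('u)"
    unfolding preserves_products_def
  proof (intro allI impI)
    fix I :: "'u set" and d n p assume I: "small I" and n: "is_product T I d n p"
    note nH = product_Hom[OF n]
    have nO: "n \<in> Ob T" and dO: "\<And>i. i \<in> I \<Longrightarrow> d i \<in> Ob T"
      using product_Ob[OF n] product_factor_Ob[OF n] by auto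
    have "cartesian I (\<lambda>i. omap ?A (d i)) (omap ?A n) (\<lambda>i. content (amap ?A (p i)))
        \<longleftrightarrow> cartesian I (\<lambda>i. R (d i)) (omap ?A n) (\<lambda>i. a (p i))"
      by (rule cartesian_cong) (simp_all add: simps(1) nO dO simps(2)[OF nH])
    then show "is_product V I (\<lambda>i. omap ?A (d i)) (omap ?A n) (\<lambda>i. amap ?A (p i))"
      unfolding product_iff_cartesian using prod[OF I n] Hom[OF nH] R nO dO
      by (simp add: simps(1))
  qed
  ultimately show ?thesis
    unfolding algebras_def by (auto simp: make_algebra_def)
qed

lemma Alg_HomD:
  assumes "\<tau> \<in> Hom (Alg T V) A B"
  shows "A \<in> algebras T V" "B \<in> algebras T V" "src \<tau> = A" "tgt \<tau> = B"
    "n \<in> Ob T \<Longrightarrow> content \<tau> n \<in> Hom V (omap A n) (omap B n)"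
  using assms unfolding Alg_Hom_iff by auto

lemma component_closed:
  "\<tau> \<in> Hom (Alg T V) A B \<Longrightarrow> n \<in> Ob T \<Longrightarrow> x \<in> Field (omap A n) \<Longrightarrow> component \<tau> n x \<in> Field (omap B n)"
  unfolding component_def by (rule monotone_HomD(1)[OF Alg_HomD(5)])

lemma component_mono:
  "\<tau> \<in> Hom (Alg T V) A B \<Longrightarrow> n \<in> Ob T \<Longrightarrow> (x, y) \<in> omap A n \<Longrightarrow> (component \<tau> n x, component \<tau> n y) \<in> omap B n"
  unfolding component_def by (rule monotone_HomD(2)[OF Alg_HomD(5)])

lemma component_natural:
  assumes \<tau>: "\<tau> \<in> Hom (Alg T V) A B" and f: "f \<in> Hom T m n" and x: "x \<in> Field (omap A m)"
  shows "component \<tau> n (action A f x) = action B f (component \<tau> m x)"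
proof -
  have m: "m \<in> Ob T" and n: "n \<in> Ob T"
    using Hom_obs[OF category f] by auto
  have "content \<tau> n \<cdot>\<^bsub>V\<^esub> amap A f = amap B f \<cdot>\<^bsub>V\<^esub> content \<tau> m"
    using \<tau> f m n unfolding Alg_Hom_iff by blast
  then have "content (content \<tau> n \<cdot>\<^bsub>V\<^esub> amap A f) x = content (amap B f \<cdot>\<^bsub>V\<^esub> content \<tau> m) x"
    by simp
  then show ?thesis
    using x by (simp add: component_def action_def monotone_comp
        monotone_src[OF algebra_Hom[OF Alg_HomD(1)[OF \<tau>] f]] monotone_src[OF Alg_HomD(5)[OF \<tau> m]])
qed

lemma Alg_Hom_eqI:
  assumes \<sigma>: "\<sigma> \<in> Hom (Alg T V) A B" and \<tau>: "\<tau> \<in> Hom (Alg T V) A B"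
    and eq: "\<And>n x. n \<in> Ob T \<Longrightarrow> x \<in> Field (omap A n) \<Longrightarrow> component \<sigma> n x = component \<tau> n x"
  shows "\<sigma> = \<tau>"
proof (rule arrow.expand)
  have "content \<sigma> = content \<tau>"
  proof (rule extensionalityI[of _ "Ob T"])
    show "content \<sigma> \<in> extensional (Ob T)" "content \<tau> \<in> extensional (Ob T)"
      using \<sigma> \<tau> unfolding Alg_Hom_iff by auto
    show "content \<sigma> n = content \<tau> n" if "n \<in> Ob T" for n
      using monotone_Hom_eqI[OF Alg_HomD(5)[OF \<sigma> that] Alg_HomD(5)[OF \<tau> that]] eq[OF that]
      unfolding component_def by blast
  qed
  then show "src \<sigma> = src \<tau> \<and> tgt \<sigma> = tgt \<tau> \<and> content \<sigma> = content \<tau>"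
    using Alg_HomD(3,4)[OF \<sigma>] Alg_HomD(3,4)[OF \<tau>] by simp
qed

lemma make_hom_in:
  assumes A: "A \<in> algebras T V" and B: "B \<in> algebras T V"
    and closed: "\<And>n x. n \<in> Ob T \<Longrightarrow> x \<in> Field (omap A n) \<Longrightarrow> h n x \<in> Field (omap B n)"
    and mono: "\<And>n x y. n \<in> Ob T \<Longrightarrow> (x, y) \<in> omap A n \<Longrightarrow> (h n x, h n y) \<in> omap B n"
    and natural: "\<And>f m n x. f \<in> Hom T m n \<Longrightarrow> x \<in> Field (omap A m) \<Longrightarrow>
        h n (action A f x) = action B f (h m x)"
  shows "make_hom T A B h \<in> Hom (Alg T V) A B"
  unfolding Alg_Hom_iff
proof (intro conjI ballI)
  let ?\<tau> = "make_hom T A B h"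
  show Hom: "content ?\<tau> n \<in> Hom V (omap A n) (omap B n)" if "n \<in> Ob T" for n
    using that monotone_HomI[OF algebra_carrier[OF A that] algebra_carrier[OF B that] closed mono]
    by (simp add: make_hom_def)
  show "content ?\<tau> n \<cdot>\<^bsub>V\<^esub> amap A f = amap B f \<cdot>\<^bsub>V\<^esub> content ?\<tau> m"
    if m: "m \<in> Ob T" and n: "n \<in> Ob T" and f: "f \<in> Hom T m n" for m n f
  proof (rule monotone_Hom_eqI[OF monotone_Hom_comp[OF algebra_Hom[OF A f] Hom[OF n]]
        monotone_Hom_comp[OF Hom[OF m] algebra_Hom[OF B f]]])
    fix x assume x: "x \<in> Field (omap A m)"
    show "content (content ?\<tau> n \<cdot>\<^bsub>V\<^esub> amap A f) x = content (amap B f \<cdot>\<^bsub>V\<^esub> content ?\<tau> m) x"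
      using natural[OF f x] x action_closed[OF A f x] m n
      by (simp add: monotone_comp monotone_src[OF algebra_Hom[OF A f]] make_hom_def action_def)
  qed
qed (use A B in \<open>auto simp: make_hom_def\<close>)

lemma Alg_comp:
  assumes \<sigma>: "\<sigma> \<in> Hom (Alg T V) A B" and \<tau>: "\<tau> \<in> Hom (Alg T V) B C"
  shows "\<tau> \<cdot>\<^bsub>Alg T V\<^esub> \<sigma> \<in> Hom (Alg T V) A C"
    and "n \<in> Ob T \<Longrightarrow> x \<in> Field (omap A n) \<Longrightarrow>
      component (\<tau> \<cdot>\<^bsub>Alg T V\<^esub> \<sigma>) n x = component \<tau> n (component \<sigma> n x)"
proof -
  note A = Alg_HomD(1)[OF \<sigma>] and B = Alg_HomD(2)[OF \<sigma>] and C = Alg_HomD(2)[OF \<tau>]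
  have comp: "\<tau> \<cdot>\<^bsub>Alg T V\<^esub> \<sigma> = Arrow A C (\<lambda>n \<in> Ob T. content \<tau> n \<cdot>\<^bsub>V\<^esub> content \<sigma> n)"
    using Alg_HomD(3)[OF \<sigma>] Alg_HomD(4)[OF \<tau>] by (simp add: Alg_def)
  have eq: "\<tau> \<cdot>\<^bsub>Alg T V\<^esub> \<sigma> = make_hom T A C (\<lambda>n x. component \<tau> n (component \<sigma> n x))"
    unfolding comp make_hom_def
  proof (intro arrow.inject[THEN iffD2] conjI refl restrict_ext)
    fix n assume n: "n \<in> Ob T"
    note s = Alg_HomD(5)[OF \<sigma> n] and t = Alg_HomD(5)[OF \<tau> n]
    show "content \<tau> n \<cdot>\<^bsub>V\<^esub> content \<sigma> n = Arrow (omap A n) (omap C n)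
        (\<lambda>x\<in>Field (omap A n). component \<tau> n (component \<sigma> n x))"
      using monotone_src[OF s] monotone_tgt[OF t]
      by (simp add: monotone_category_def compose_def component_def)
  qed
  show "\<tau> \<cdot>\<^bsub>Alg T V\<^esub> \<sigma> \<in> Hom (Alg T V) A C"
    unfolding eq
    by (rule make_hom_in[OF A C])
      (auto intro: component_closed[OF \<sigma>] component_closed[OF \<tau>] component_mono[OF \<sigma>] component_mono[OF \<tau>]
        simp: component_natural[OF \<sigma>] component_natural[OF \<tau>] component_closed[OF \<sigma>] Hom_obs[OF category])
  show "component (\<tau> \<cdot>\<^bsub>Alg T V\<^esub> \<sigma>) n x = component \<tau> n (component \<sigma> n x)"
    if "n \<in> Ob T" "x \<in> Field (omap A n)"
    unfolding eq component_make_hom[OF that] ..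
qed

lemma Alg_id:
  assumes A: "A \<in> algebras T V"
  shows "Id (Alg T V) A \<in> Hom (Alg T V) A A"
    and "n \<in> Ob T \<Longrightarrow> x \<in> Field (omap A n) \<Longrightarrow> component (Id (Alg T V) A) n x = x"
proof -
  have eq: "Id (Alg T V) A = make_hom T A A (\<lambda>n x. x)"
    by (simp add: Alg_def make_hom_def monotone_Id)
  show "Id (Alg T V) A \<in> Hom (Alg T V) A A"
    unfolding eq by (rule make_hom_in[OF A A]) simp_all
  show "component (Id (Alg T V) A) n x = x" if "n \<in> Ob T" "x \<in> Field (omap A n)"
    unfolding eq component_make_hom[OF that] ..
qed

lemma Alg_category: "is_category (Alg T V)"
  unfolding is_category_def
proof (intro conjI ballI)
  let ?C = "Alg T V"
  show "Dom ?C f \<in> Ob ?C" "Cod ?C f \<in> Ob ?C" if "f \<in> Arr ?C" for f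
    using that by (auto simp: Alg_def)
  show "Id ?C A \<in> Hom ?C A A" if "A \<in> Ob ?C" for A
    using that unfolding Alg_Ob by (rule Alg_id(1))
  show "g \<cdot>\<^bsub>?C\<^esub> f \<in> Hom ?C A D" if "f \<in> Hom ?C A B" "g \<in> Hom ?C B D" for f g A B D
    using that by (rule Alg_comp(1))
  show "f \<cdot>\<^bsub>?C\<^esub> Id ?C A = f" "Id ?C B \<cdot>\<^bsub>?C\<^esub> f = f"
    if AB: "A \<in> Ob ?C" "B \<in> Ob ?C" and f: "f \<in> Hom ?C A B" for f A B
  proof -
    note A = Alg_id[OF AB(1)[unfolded Alg_Ob]] and B = Alg_id[OF AB(2)[unfolded Alg_Ob]]
    show "f \<cdot>\<^bsub>?C\<^esub> Id ?C A = f"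
      by (rule Alg_Hom_eqI[OF Alg_comp(1)[OF A(1) f] f]) (simp add: Alg_comp(2)[OF A(1) f] A(2))
    show "Id ?C B \<cdot>\<^bsub>?C\<^esub> f = f"
      by (rule Alg_Hom_eqI[OF Alg_comp(1)[OF f B(1)] f])
        (simp add: Alg_comp(2)[OF f B(1)] B(2) component_closed[OF f])
  qed
  show "h \<cdot>\<^bsub>?C\<^esub> (g \<cdot>\<^bsub>?C\<^esub> f) = h \<cdot>\<^bsub>?C\<^esub> g \<cdot>\<^bsub>?C\<^esub> f"
    if f: "f \<in> Hom ?C A B" and g: "g \<in> Hom ?C B D" and h: "h \<in> Hom ?C D E" for f g h A B D E
    by (rule Alg_Hom_eqI[OF Alg_comp(1)[OF Alg_comp(1)[OF f g] h] Alg_comp(1)[OF f Alg_comp(1)[OF g h]]])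
      (simp add: Alg_comp(2)[OF Alg_comp(1)[OF f g] h] Alg_comp(2)[OF f Alg_comp(1)[OF g h]]
        Alg_comp(2)[OF f g] Alg_comp(2)[OF g h] component_closed[OF f])
qed

lemma Alg_Le:
  assumes "\<sigma> \<in> Hom (Alg T V) A B" "\<tau> \<in> Hom (Alg T V) A B" "cardinal_one \<in> Ob T"
  shows "Le (Alg T V) \<sigma> \<tau> \<longleftrightarrow> (\<forall>x \<in> Field (omap A cardinal_one).
    (component \<sigma> cardinal_one x, component \<tau> cardinal_one x) \<in> omap B cardinal_one)"
  using monotone_src[OF Alg_HomD(5)[OF assms(1,3)]] monotone_tgt[OF Alg_HomD(5)[OF assms(1,3)]]
  by (simp add: Alg_def monotone_Le component_def)

end

section \<open>Ordered algebras among preordered algebras\<close>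

definition preorders :: "'u rel set" where
  "preorders = {r. Preorder r \<and> small (Field r)}"

definition posets :: "'u rel set" where
  "posets = {r. Partial_order r \<and> small (Field r)}"

lemma Ord_eq: "Ord = monotone_category preorders" and Pos_eq: "Pos = monotone_category posets"
  by (simp_all add: Ord_def Pos_def preorders_def posets_def)

abbreviation PreV :: "('u rel, ('u rel, 'u \<Rightarrow> 'u) arrow) ocategory" where
  "PreV \<equiv> monotone_category preorders"

lemma separating_preorders:
  assumes "infinite (UNIV :: 'u set)"
  shows "separating_class (preorders :: 'u rel set)"
  by unfold_locales (use assms in \<open>auto simp: preorders_def\<close>)

lemma separating_posets:
  assumes "infinite (UNIV :: 'u set)"
  shows "separating_class (posets :: 'u rel set)"
proof
  show "infinite (UNIV :: 'u set)" by fact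
  show "Preorder r \<and> small (Field r)" if "r \<in> posets" for r :: "'u rel"
    using that by (simp add: posets_def partial_order_on_def)
  fix r :: "'u rel"
  assume r: "Preorder r" "small (Field r)"
    and sep: "\<And>x y. \<lbrakk>(x, y) \<in> r; (y, x) \<in> r; x \<noteq> y\<rbrakk> \<Longrightarrow>
      \<exists>s g. s \<in> (posets :: 'u rel set) \<and> (\<forall>u v. (u, v) \<in> r \<longrightarrow> (g u, g v) \<in> s) \<and> g x \<noteq> g y"
  have "antisym r"
  proof (rule antisymI, rule ccontr)
    fix x y assume xy: "(x, y) \<in> r" "(y, x) \<in> r" and ne: "x \<noteq> y"
    from sep[OF xy ne] obtain s :: "'u rel" and g where s: "s \<in> posets" "g x \<noteq> g y"
      and g: "\<forall>u v. (u, v) \<in> r \<longrightarrow> (g u, g v) \<in> s"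
      by blast
    have "antisym s"
      using s(1) by (simp add: posets_def partial_order_on_def)
    then show False
      using g xy s(2) by (blast dest: antisymD)
  qed
  then show "r \<in> posets"
    using r by (simp add: posets_def partial_order_on_def)
qed

lemma monotone_Hom_superset:
  "r \<in> \<O> \<Longrightarrow> s \<in> \<O> \<Longrightarrow> \<O> \<subseteq> \<O>' \<Longrightarrow> f \<in> Hom (monotone_category \<O>) r s \<longleftrightarrow> f \<in> Hom (monotone_category \<O>') r s"
  unfolding monotone_Hom_iff by blast

lemma monotone_comp_superset:
  "g \<cdot>\<^bsub>monotone_category \<O>\<^esub> f = g \<cdot>\<^bsub>monotone_category \<O>'\<^esub> f"
  by (simp add: monotone_category_def)

lemma monotone_Id_superset:
  "Id (monotone_category \<O>) r = Id (monotone_category \<O>') r"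
  by (simp add: monotone_category_def)

context algebras_over
begin

lemma sub_preorders: "\<O> \<subseteq> preorders"
  using small_preorder by (auto simp: preorders_def)

lemma over_preorders: "algebras_over preorders T"
  by (intro algebras_over.intro separating_preorders infinite_universe algebras_over_axioms.intro category)

interpretation ord: algebras_over preorders T
  by (rule over_preorders)

text \<open>
  Composition, identities, hom-sets and products mean the same for members of \<open>\<O>\<close> as for arbitrary
  preorders. With the next lemma, the algebras over \<open>\<O>\<close> form a full subcategory of the preordered
  algebras.
\<close>

lemma algebras_iff_preorders:
  "A \<in> algebras T V \<longleftrightarrow> A \<in> algebras T PreV \<and> (\<forall>n \<in> Ob T. omap A n \<in> \<O>)"
proof -
  have "is_functor T V A \<and> preserves_products T V A TYPE('u)
      \<longleftrightarrow> is_functor T PreV A \<and> preserves_products T PreV A TYPE('u)"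
    if ob: "\<forall>n \<in> Ob T. omap A n \<in> \<O>"
  proof -
    have H: "f \<in> Hom V (omap A m) (omap A n) \<longleftrightarrow> f \<in> Hom PreV (omap A m) (omap A n)"
      if "m \<in> Ob T" "n \<in> Ob T" for f m n
      using monotone_Hom_superset[OF _ _ sub_preorders] ob that by blast
    have "is_functor T V A \<longleftrightarrow> is_functor T PreV A"
      unfolding is_functor_def monotone_Ob monotone_comp_superset[where \<O> = \<O> and \<O>' = preorders]
        monotone_Id_superset[where \<O> = \<O> and \<O>' = preorders]
      by (intro conj_cong ball_cong refl H) (use ob sub_preorders in blast)+
    moreover have "is_product V I (\<lambda>i. omap A (d i)) (omap A n) (\<lambda>i. amap A (p i))
      \<longleftrightarrow> is_product PreV I (\<lambda>i. omap A (d i)) (omap A n) (\<lambda>i. amap A (p i))"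
      if "is_product T I d n p" for I :: "'u set" and d n p
    proof -
      have nO: "n \<in> Ob T" and dO: "\<And>i. i \<in> I \<Longrightarrow> d i \<in> Ob T"
        using product_Ob[OF that] product_factor_Ob[OF that] by auto
      show ?thesis
        unfolding product_iff_cartesian ord.product_iff_cartesian
        by (intro conj_cong ball_cong refl H nO dO) (use ob sub_preorders nO dO in blast)+
    qed
    ultimately show ?thesis
      unfolding preserves_products_def by simp
  qed
  moreover have "A \<in> algebras T V \<Longrightarrow> \<forall>n \<in> Ob T. omap A n \<in> \<O>"
    using algebra_carrier by blast
  ultimately show ?thesis
    unfolding algebras_def mem_Collect_eq by blast
qed

lemma Alg_Hom_preorders:
  assumes "A \<in> algebras T V" "B \<in> algebras T V"
  shows "\<tau> \<in> Hom (Alg T V) A B \<longleftrightarrow> \<tau> \<in> Hom (Alg T PreV) A B"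
proof -
  have "content \<tau> n \<in> Hom V (omap A n) (omap B n) \<longleftrightarrow> content \<tau> n \<in> Hom PreV (omap A n) (omap B n)"
    if "n \<in> Ob T" for n
    using monotone_Hom_superset[OF _ _ sub_preorders] algebra_carrier assms that by blast
  then show ?thesis
    unfolding Alg_Hom_iff monotone_comp_superset[where \<O> = \<O> and \<O>' = preorders]
    using assms algebras_iff_preorders by auto
qed

text \<open>
  Naturality of the induced map can be checked on preimages under the surjection \<open>p\<close>, where it is
  the naturality of \<open>h\<close>.
\<close>

lemma hom_factor:
  assumes p: "p \<in> Hom (Alg T PreV) F A" and h: "h \<in> Hom (Alg T PreV) F B"
    and surj: "\<And>n y. n \<in> Ob T \<Longrightarrow> y \<in> Field (omap A n) \<Longrightarrow> \<exists>x \<in> Field (omap F n). component p n x = y"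
    and le: "\<And>n x y. \<lbrakk>n \<in> Ob T; x \<in> Field (omap F n); y \<in> Field (omap F n);
      (component p n x, component p n y) \<in> omap A n\<rbrakk> \<Longrightarrow> (component h n x, component h n y) \<in> omap B n"
    and eq: "\<And>n x y. \<lbrakk>n \<in> Ob T; x \<in> Field (omap F n); y \<in> Field (omap F n);
      component p n x = component p n y\<rbrakk> \<Longrightarrow> component h n x = component h n y"
  obtains t where "t \<in> Hom (Alg T PreV) A B"
    "\<And>n x. n \<in> Ob T \<Longrightarrow> x \<in> Field (omap F n) \<Longrightarrow> component t n (component p n x) = component h n x"
proof -
  note F = ord.Alg_HomD(1)[OF p] and A = ord.Alg_HomD(2)[OF p] and B = ord.Alg_HomD(2)[OF h]
  define s where "s n y = (SOME x. x \<in> Field (omap F n) \<and> component p n x = y)" for n y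
  have s: "s n y \<in> Field (omap F n)" "component p n (s n y) = y"
    if "n \<in> Ob T" "y \<in> Field (omap A n)" for n y
    using someI_ex[of "\<lambda>x. x \<in> Field (omap F n) \<and> component p n x = y"] surj[OF that]
    unfolding s_def by blast+
  let ?t = "make_hom T A B (\<lambda>n y. component h n (s n y))"
  have hs: "component h n (s n (component p n x)) = component h n x"
    if "n \<in> Ob T" "x \<in> Field (omap F n)" for n x
    using s[OF that(1) ord.component_closed[OF p that]] that by (intro eq) auto
  have t: "?t \<in> Hom (Alg T PreV) A B"
  proof (rule ord.make_hom_in[OF A B])
    show "component h n (s n y) \<in> Field (omap B n)" if "n \<in> Ob T" "y \<in> Field (omap A n)" for n y
      by (rule ord.component_closed[OF h that(1) s(1)[OF that]])
    show "(component h n (s n x), component h n (s n y)) \<in> omap B n"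
      if n: "n \<in> Ob T" and xy: "(x, y) \<in> omap A n" for n x y
      using s[OF n FieldI1[OF xy]] s[OF n FieldI2[OF xy]] xy by (intro le n) simp_all
    show "component h n (s n (action A f y)) = action B f (component h m (s m y))"
      if f: "f \<in> Hom T m n" and y: "y \<in> Field (omap A m)" for f m n y
    proof -
      have mn: "m \<in> Ob T" "n \<in> Ob T"
        using Hom_obs[OF category f] by auto
      note sy = s[OF mn(1) y]
      have "action A f y = component p n (action F f (s m y))"
        using ord.component_natural[OF p f sy(1)] sy(2) by simp
      then show ?thesis
        using hs[OF mn(2) ord.action_closed[OF F f sy(1)]] ord.component_natural[OF h f sy(1)] by simp
    qed
  qed
  show thesis
    by (rule that[OF t]) (simp add: component_make_hom ord.component_closed[OF p] hs)
qed

end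

section \<open>Factorization of sources\<close>

context algebras_over
begin

interpretation ord: algebras_over preorders T
  by (rule over_preorders)

text \<open>
  Let \<open>eq\<close> and \<open>le\<close> be the equality and order that the family \<open>H\<close> imposes on each \<open>F(n)\<close>, both
  stable under the operations. The carriers of \<open>A\<close> consist of one representative of each
  \<open>eq\<close>-class, so they are small however large the family is. Order and equality of tuples are
  determined componentwise in \<open>A\<close> because they are in every target \<open>B\<close>, and a tuple of
  representatives is already the tuple of components of an element of \<open>F(n)\<close>. If \<open>x\<close> and \<open>y\<close>
  are distinct representatives, then some \<open>h\<close> separates them, which places \<open>A(n)\<close> in the class \<open>\<O>\<close>.
\<close>

lemma source_factorization:
  fixes H :: "('u, 't) algebra \<Rightarrow> ('u, 't) hom \<Rightarrow> bool"
  assumes F: "F \<in> algebras T PreV"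
    and H: "\<And>B h. H B h \<Longrightarrow> B \<in> algebras T V \<and> h \<in> Hom (Alg T PreV) F B"
  obtains A p where "A \<in> algebras T V" "p \<in> Hom (Alg T PreV) F A"
    "\<And>n y. n \<in> Ob T \<Longrightarrow> y \<in> Field (omap A n) \<Longrightarrow> \<exists>x \<in> Field (omap F n). component p n x = y"
    "\<And>n x y. \<lbrakk>n \<in> Ob T; x \<in> Field (omap F n); y \<in> Field (omap F n)\<rbrakk> \<Longrightarrow>
      (component p n x, component p n y) \<in> omap A n \<longleftrightarrow>
      (\<forall>B h. H B h \<longrightarrow> (component h n x, component h n y) \<in> omap B n)"
    "\<And>n x y. \<lbrakk>n \<in> Ob T; x \<in> Field (omap F n); y \<in> Field (omap F n)\<rbrakk> \<Longrightarrow>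
      component p n x = component p n y \<longleftrightarrow>
      (\<forall>B h. H B h \<longrightarrow> component h n x = component h n y)"
proof -
  have HB: "B \<in> algebras T PreV" if "H B h" for B h
    using H[OF that] algebras_iff_preorders by blast
  have Hh: "h \<in> Hom (Alg T PreV) F B" if "H B h" for B h
    using H[OF that] by blast
  define le where "le n x y \<longleftrightarrow> (\<forall>B h. H B h \<longrightarrow> (component h n x, component h n y) \<in> omap B n)" for n x y
  define eq where "eq n x y \<longleftrightarrow> (\<forall>B h. H B h \<longrightarrow> component h n x = component h n y)" for n x y
  \<comment> \<open>equal elements have equal classes, so the same representative is chosen for all of a class\<close>
  define rep where "rep n x = (SOME y. y \<in> Field (omap F n) \<and> eq n x y)" for n x
  have eq_refl: "eq n x x" for n x
    by (simp add: eq_def)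
  have eq_sym: "eq n x y \<Longrightarrow> eq n y x" and eq_trans: "eq n x y \<Longrightarrow> eq n y z \<Longrightarrow> eq n x z" for n x y z
    unfolding eq_def by simp_all
  have rep: "rep n x \<in> Field (omap F n)" "eq n x (rep n x)" if "x \<in> Field (omap F n)" for n x
    using someI[of "\<lambda>y. y \<in> Field (omap F n) \<and> eq n x y" x] that eq_refl unfolding rep_def by blast+
  have rep_eq: "rep n x = rep n y" if "eq n x y" for n x y
  proof -
    have "eq n x = eq n y"
      using that eq_sym eq_trans by blast
    then show ?thesis
      unfolding rep_def by simp
  qed
  have rep_iff: "rep n x = rep n y \<longleftrightarrow> eq n x y" if "x \<in> Field (omap F n)" "y \<in> Field (omap F n)" for n x y
    using rep_eq rep(2)[OF that(1)] rep(2)[OF that(2)] eq_sym eq_trans by metis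
  have le_cong: "le n x y \<longleftrightarrow> le n x' y'" if "eq n x x'" "eq n y y'" for n x y x' y'
    using that unfolding le_def eq_def by simp
  have le_refl: "le n x x" if "n \<in> Ob T" "x \<in> Field (omap F n)" for n x
    unfolding le_def using Preorder_refl[OF ord.algebra_preorder[OF HB that(1)] ord.component_closed[OF Hh that]] by blast
  have le_trans: "le n x z" if "n \<in> Ob T" "le n x y" "le n y z" for n x y z
    using that Preorder_trans[OF ord.algebra_preorder[OF HB that(1)]] unfolding le_def by blast
  have le_action: "le n (action F f x) (action F f y)"
    if f: "f \<in> Hom T m n" and xy: "x \<in> Field (omap F m)" "y \<in> Field (omap F m)" and "le m x y" for f m n x y
    using that(4) ord.action_mono[OF HB f] unfolding le_def
    by (simp add: ord.component_natural[OF Hh f xy(1)] ord.component_natural[OF Hh f xy(2)])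
  have eq_action: "eq n (action F f x) (action F f y)"
    if f: "f \<in> Hom T m n" and xy: "x \<in> Field (omap F m)" "y \<in> Field (omap F m)" and "eq m x y" for f m n x y
    using that(4) unfolding eq_def
    by (simp add: ord.component_natural[OF Hh f xy(1)] ord.component_natural[OF Hh f xy(2)])
  define R where "R n = {(x, y). x \<in> rep n ` Field (omap F n) \<and> y \<in> rep n ` Field (omap F n) \<and> le n x y}" for n
  define a where "a f x = rep (Cod T f) (action F f x)" for f x
  have repF: "x \<in> Field (omap F n)" if "x \<in> rep n ` Field (omap F n)" for n x
    using that rep(1) by auto
  have rep_rep: "rep n x = x" if "x \<in> rep n ` Field (omap F n)" for n x
    using that rep rep_eq eq_sym by force
  have field: "Field (R n) = rep n ` Field (omap F n)" if "n \<in> Ob T" for n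
  proof
    show "Field (R n) \<subseteq> rep n ` Field (omap F n)"
      unfolding R_def Field_def by blast
    show "rep n ` Field (omap F n) \<subseteq> Field (R n)"
    proof
      fix x assume x: "x \<in> rep n ` Field (omap F n)"
      have "(x, x) \<in> R n"
        using le_refl[OF \<open>n \<in> Ob T\<close> repF[OF x]] x unfolding R_def by blast
      then show "x \<in> Field (R n)"
        by (rule FieldI1)
    qed
  qed
  have R_in: "R n \<in> \<O>" if n: "n \<in> Ob T" for n
  proof (rule separated)
    show "Preorder (R n)"
    proof (rule PreorderI)
      show "(x, x) \<in> R n \<and> (y, y) \<in> R n" if "(x, y) \<in> R n" for x y
        using that le_refl[OF n] repF unfolding R_def by blast
      show "(x, z) \<in> R n" if "(x, y) \<in> R n" "(y, z) \<in> R n" for x y z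
        using that le_trans[OF n] unfolding R_def by blast
    qed
    show "small (Field (R n))"
      unfolding field[OF n] using small_image ord.small_preorder ord.algebra_carrier[OF F n] by blast
    show "\<exists>s g. s \<in> \<O> \<and> (\<forall>u v. (u, v) \<in> R n \<longrightarrow> (g u, g v) \<in> s) \<and> g x \<noteq> g y"
      if "(x, y) \<in> R n" "(y, x) \<in> R n" "x \<noteq> y" for x y
    proof -
      have "rep n x \<noteq> rep n y"
        using that rep_rep[of x n] rep_rep[of y n] unfolding R_def by simp
      then have "\<not> eq n x y"
        using rep_eq[of n x y] by blast
      then obtain B h where Bh: "H B h" "component h n x \<noteq> component h n y"
        unfolding eq_def by blast
      show ?thesis
      proof (intro exI conjI)
        show "omap B n \<in> \<O>"
          using H[OF Bh(1)] algebra_carrier n by blast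
        show "component h n x \<noteq> component h n y" by fact
        show "\<forall>u v. (u, v) \<in> R n \<longrightarrow> (component h n u, component h n v) \<in> omap B n"
          using Bh(1) unfolding R_def le_def by blast
      qed
    qed
  qed
  have R_iff: "(rep n x, rep n y) \<in> R n \<longleftrightarrow> le n x y" if "x \<in> Field (omap F n)" "y \<in> Field (omap F n)" for n x y
    using that le_cong[OF rep(2)[OF that(1)] rep(2)[OF that(2)]] by (simp add: R_def)
  have a_rep: "a f x = rep n (action F f x)" if "f \<in> Hom T m n" for f m n x
    using that by (simp add: a_def Hom_def)
  let ?A = "make_algebra T R a"
  have A: "?A \<in> algebras T V"
  proof (rule make_algebra_in[OF R_in])
    fix f m n assume f: "f \<in> Hom T m n"
    have mn: "m \<in> Ob T" "n \<in> Ob T"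
      using Hom_obs[OF category f] by auto
    show "a f x \<in> Field (R n)" if "x \<in> Field (R m)" for x
      using that ord.action_closed[OF F f] repF by (simp add: field mn a_rep[OF f])
    show "(a f x, a f y) \<in> R n" if "(x, y) \<in> R m" for x y
    proof -
      have xy: "x \<in> Field (omap F m)" "y \<in> Field (omap F m)" "le m x y"
        using that repF unfolding R_def by auto
      show ?thesis
        using le_action[OF f xy] by (simp add: a_rep[OF f] R_iff ord.action_closed[OF F f] xy)
    qed
  next
    fix n x assume n: "n \<in> Ob T" and x: "x \<in> Field (R n)"
    show "a (Id T n) x = x"
    proof -
      have x': "x \<in> rep n ` Field (omap F n)"
        using x field[OF n] by simp
      show ?thesis
        unfolding a_rep[OF Hom_id[OF category n]] ord.action_id[OF F n repF[OF x']] by (rule rep_rep[OF x'])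
    qed
  next
    fix f g k m n x assume f: "f \<in> Hom T k m" and g: "g \<in> Hom T m n" and x: "x \<in> Field (R k)"
    have xF: "x \<in> Field (omap F k)"
      using x field[of k] Hom_obs[OF category f] by (intro repF) blast
    note fx = ord.action_closed[OF F f xF]
    show "a (g \<cdot>\<^bsub>T\<^esub> f) x = a g (a f x)"
      unfolding a_rep[OF Hom_comp[OF category f g]] a_rep[OF g] a_rep[OF f] ord.action_comp[OF F f g xF]
      by (intro rep_eq eq_action[OF g fx] rep fx)
  next
    fix I :: "'u set" and d n q assume I: "small I" and q: "is_product T I d n q"
    have n: "n \<in> Ob T" and d: "\<And>i. i \<in> I \<Longrightarrow> d i \<in> Ob T"
      using product_Ob[OF q] product_factor_Ob[OF q] by auto
    note qH = product_Hom[OF q]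
    have act: "component h (d i) (action F (q i) x) = action B (q i) (component h n x)"
      if "H B h" "i \<in> I" "x \<in> Field (omap F n)" for B h i x
      using ord.component_natural[OF Hh[OF that(1)] qH[OF that(2)] that(3)] .
    have fields: "x \<in> Field (omap F n)" "rep n x = x" if "x \<in> Field (R n)" for x
      using that unfolding field[OF n] by (rule repF, rule rep_rep)
    show "cartesian I (\<lambda>i. R (d i)) (R n) (\<lambda>i. a (q i))"
      unfolding cartesian_def
    proof (intro conjI ballI allI impI)
      fix x y assume x: "x \<in> Field (R n)" and y: "y \<in> Field (R n)"
      note xF = fields[OF x] and yF = fields[OF y]
      { assume *: "\<forall>i\<in>I. (a (q i) x, a (q i) y) \<in> R (d i)"
        have le: "le (d i) (action F (q i) x) (action F (q i) y)" if "i \<in> I" for i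
          using bspec[OF * that] unfolding a_rep[OF qH[OF that]]
          by (simp only: R_iff ord.action_closed[OF F qH[OF that] xF(1)] ord.action_closed[OF F qH[OF that] yF(1)])
        have "le n x y"
          unfolding le_def
        proof (intro allI impI)
          fix B h assume Bh: "H B h"
          show "(component h n x, component h n y) \<in> omap B n"
          proof (rule cartesian_le[OF ord.algebra_cartesian[OF HB[OF Bh] I q]])
            show "component h n x \<in> Field (omap B n)" "component h n y \<in> Field (omap B n)"
              using ord.component_closed[OF Hh[OF Bh] n] xF yF by auto
            show "(action B (q i) (component h n x), action B (q i) (component h n y)) \<in> omap B (d i)"
              if "i \<in> I" for i
              using le[OF that] Bh unfolding le_def
              by (simp add: act[OF Bh that xF(1), symmetric] act[OF Bh that yF(1), symmetric])
          qed
        qed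
        then show "(x, y) \<in> R n"
          using R_iff[OF xF(1) yF(1)] xF(2) yF(2) by simp }
      { assume *: "\<forall>i\<in>I. a (q i) x = a (q i) y"
        have eq: "eq (d i) (action F (q i) x) (action F (q i) y)" if "i \<in> I" for i
          using bspec[OF * that] unfolding a_rep[OF qH[OF that]]
          by (simp only: rep_iff ord.action_closed[OF F qH[OF that] xF(1)] ord.action_closed[OF F qH[OF that] yF(1)])
        have "eq n x y"
          unfolding eq_def
        proof (intro allI impI)
          fix B h assume Bh: "H B h"
          show "component h n x = component h n y"
          proof (rule cartesian_eq[OF ord.algebra_cartesian[OF HB[OF Bh] I q]])
            show "component h n x \<in> Field (omap B n)" "component h n y \<in> Field (omap B n)"
              using ord.component_closed[OF Hh[OF Bh] n] xF yF by auto
            show "action B (q i) (component h n x) = action B (q i) (component h n y)"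
              if "i \<in> I" for i
              using eq[OF that] Bh unfolding eq_def
              by (simp add: act[OF Bh that xF(1), symmetric] act[OF Bh that yF(1), symmetric])
          qed
        qed
        then show "x = y"
          using rep_iff[OF xF(1) yF(1)] xF(2) yF(2) by simp }
    next
      fix z assume z: "\<forall>i\<in>I. z i \<in> Field (R (d i))"
      then have "z i \<in> Field (omap F (d i))" if "i \<in> I" for i
        using that repF[of "z i" "d i"] field[OF d[OF that]] by blast
      then obtain x where x: "x \<in> Field (omap F n)" "\<And>i. i \<in> I \<Longrightarrow> action F (q i) x = z i"
        by (rule cartesian_tuple[OF ord.algebra_cartesian[OF F I q], of z]) blast+
      have "a (q i) (rep n x) = z i" if "i \<in> I" for i
      proof -
        have "a (q i) (rep n x) = rep (d i) (action F (q i) x)"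
          unfolding a_rep[OF qH[OF that]]
          by (intro rep_eq eq_sym[OF eq_action[OF qH[OF that] x(1)]] rep x(1))
        then show ?thesis
          using x(2)[OF that] bspec[OF z that] rep_rep[of "z i" "d i"] field[OF d[OF that]] by simp
      qed
      then show "\<exists>x\<in>Field (R n). \<forall>i\<in>I. a (q i) x = z i"
        using x(1) unfolding field[OF n] by blast
    qed
  qed
  have A': "?A \<in> algebras T PreV"
    using A algebras_iff_preorders by blast
  let ?p = "make_hom T F ?A rep"
  have p: "?p \<in> Hom (Alg T PreV) F ?A"
  proof (rule ord.make_hom_in[OF F A'])
    show "rep n x \<in> Field (omap ?A n)" if "n \<in> Ob T" "x \<in> Field (omap F n)" for n x
      using that by (simp add: make_algebra_simps field)
    show "(rep n x, rep n y) \<in> omap ?A n" if n: "n \<in> Ob T" and xy: "(x, y) \<in> omap F n" for n x y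
    proof -
      have "le n x y"
        using ord.component_mono[OF Hh n xy] unfolding le_def by blast
      then show ?thesis
        using R_iff[OF FieldI1[OF xy] FieldI2[OF xy]] by (simp add: make_algebra_simps n)
    qed
    show "rep n (action F f x) = action ?A f (rep m x)" if f: "f \<in> Hom T m n" and x: "x \<in> Field (omap F m)" for f m n x
    proof -
      have "rep m x \<in> Field (R m)"
        using Hom_obs[OF category f] x by (simp add: field)
      then have "action ?A f (rep m x) = rep n (action F f (rep m x))"
        by (simp add: make_algebra_simps(3)[OF f] a_rep[OF f])
      then show ?thesis
        using rep_eq[OF eq_action[OF f x rep(1)[OF x] rep(2)[OF x]]] by simp
    qed
  qed
  show thesis
  proof (rule that[OF A p])
    show "\<exists>x\<in>Field (omap F n). component ?p n x = y" if n: "n \<in> Ob T" and "y \<in> Field (omap ?A n)" for n y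
      using that(2) by (auto simp: make_algebra_simps field n component_make_hom)
    fix n x y assume "n \<in> Ob T" "x \<in> Field (omap F n)" "y \<in> Field (omap F n)"
    then show "(component ?p n x, component ?p n y) \<in> omap ?A n \<longleftrightarrow>
        (\<forall>B h. H B h \<longrightarrow> (component h n x, component h n y) \<in> omap B n)"
      "component ?p n x = component ?p n y \<longleftrightarrow> (\<forall>B h. H B h \<longrightarrow> component h n x = component h n y)"
      by (simp_all add: component_make_hom make_algebra_simps R_iff rep_iff le_def eq_def)
  qed
qed

end

section \<open>The ordered category of algebras\<close>

lemma product_factor_cong:
  assumes "is_product C I d n p" "\<And>i. i \<in> I \<Longrightarrow> d i = d' i"
  shows "is_product C I d' n p"
  using assms unfolding is_product_def by (simp cong: ball_cong)

context algebras_over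
begin

lemma Alg_preordered:
  assumes one: "cardinal_one \<in> Ob T"
  shows "preordered_category (Alg T V)"
  unfolding preordered_category_def Alg_Ob
proof (intro conjI ballI impI)
  let ?C = "Alg T V"
  show "is_category ?C"
    by (rule Alg_category)
  show "Le ?C f f" if f: "f \<in> Hom ?C A B" for A B f
    unfolding Alg_Le[OF f f one]
    using Preorder_refl[OF algebra_preorder[OF Alg_HomD(2)[OF f] one]] component_closed[OF f one] by blast
  show "Le ?C f h" if f: "f \<in> Hom ?C A B" and g: "g \<in> Hom ?C A B" and h: "h \<in> Hom ?C A B"
    and "Le ?C f g" "Le ?C g h" for A B f g h
    using that(4,5) Preorder_trans[OF algebra_preorder[OF Alg_HomD(2)[OF f] one]]
    unfolding Alg_Le[OF f h one] Alg_Le[OF f g one] Alg_Le[OF g h one] by blast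
  fix A B D f f' g g'
  assume f: "f \<in> Hom ?C A B" and f': "f' \<in> Hom ?C A B" and g: "g \<in> Hom ?C B D" and g': "g' \<in> Hom ?C B D"
  show "Le ?C (g \<cdot>\<^bsub>?C\<^esub> f) (g \<cdot>\<^bsub>?C\<^esub> f')" if "Le ?C f f'"
    using that component_mono[OF g one]
    unfolding Alg_Le[OF f f' one] Alg_Le[OF Alg_comp(1)[OF f g] Alg_comp(1)[OF f' g] one]
    by (simp add: Alg_comp(2)[OF f g one] Alg_comp(2)[OF f' g one])
  show "Le ?C (g \<cdot>\<^bsub>?C\<^esub> f) (g' \<cdot>\<^bsub>?C\<^esub> f)" if "Le ?C g g'"
    using that component_closed[OF f one]
    unfolding Alg_Le[OF g g' one] Alg_Le[OF Alg_comp(1)[OF f g] Alg_comp(1)[OF f g'] one]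
    by (simp add: Alg_comp(2)[OF f g one] Alg_comp(2)[OF f g' one])
qed

text \<open>
  Homomorphisms are compared at \<open>1\<close> only, but their values at \<open>n\<close> are determined by those at \<open>1\<close>
  through the \<open>n\<close> projections. Hence antisymmetry at \<open>1\<close> gives antisymmetry of the hom-sets.
\<close>

lemma Alg_Hom_eq_at_one:
  assumes th: "algebraic_theory T"
    and \<sigma>: "\<sigma> \<in> Hom (Alg T V) A B" and \<tau>: "\<tau> \<in> Hom (Alg T V) A B"
    and eq: "\<And>x. x \<in> Field (omap A cardinal_one) \<Longrightarrow> component \<sigma> cardinal_one x = component \<tau> cardinal_one x"
  shows "\<sigma> = \<tau>"
proof (rule Alg_Hom_eqI[OF \<sigma> \<tau>])
  fix n x assume n: "n \<in> Ob T" and x: "x \<in> Field (omap A n)"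
  obtain p where p: "is_product T (below n) (\<lambda>_. cardinal_one) n p"
    using theory_power[OF th] n theory_Ob[OF th] by blast
  show "component \<sigma> n x = component \<tau> n x"
  proof (rule cartesian_eq[OF algebra_cartesian[OF Alg_HomD(2)[OF \<sigma>] small_below p]])
    show "component \<sigma> n x \<in> Field (omap B n)" "component \<tau> n x \<in> Field (omap B n)"
      by (rule component_closed[OF \<sigma> n x], rule component_closed[OF \<tau> n x])
    fix i assume i: "i \<in> below n"
    note pi = product_Hom[OF p i]
    show "action B (p i) (component \<sigma> n x) = action B (p i) (component \<tau> n x)"
      unfolding component_natural[OF \<sigma> pi x, symmetric] component_natural[OF \<tau> pi x, symmetric]
      by (rule eq[OF action_closed[OF Alg_HomD(1)[OF \<sigma>] pi x]])
  qed
qed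

lemma Alg_ordered:
  assumes th: "algebraic_theory T" and antisym: "\<And>r. r \<in> \<O> \<Longrightarrow> antisym r"
  shows "ordered_category (Alg T V)"
proof -
  have one: "cardinal_one \<in> Ob T"
    using cardinal_one_in(1)[OF infinite_universe] theory_Ob[OF th] by simp
  have "\<sigma> = \<tau>"
    if \<sigma>: "\<sigma> \<in> Hom (Alg T V) A B" and \<tau>: "\<tau> \<in> Hom (Alg T V) A B"
      and "Le (Alg T V) \<sigma> \<tau>" "Le (Alg T V) \<tau> \<sigma>" for A B \<sigma> \<tau>
    using that(3,4) antisymD[OF antisym[OF algebra_carrier[OF Alg_HomD(2)[OF \<sigma>] one]]]
    unfolding Alg_Le[OF \<sigma> \<tau> one] Alg_Le[OF \<tau> \<sigma> one]
    by (intro Alg_Hom_eq_at_one[OF th \<sigma> \<tau>]) blast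
  then show ?thesis
    unfolding ordered_category_def using Alg_preordered[OF one] by blast
qed

end

section \<open>The algebraic functor of a theory morphism\<close>

locale theory_morphism_over = separating_class \<O> for \<O> :: "'u rel set" +
  fixes S :: "('u, 's) category" and T :: "('u, 't) category" and K :: "('u, 's, 'u, 't) cfunctor"
  assumes regular: "regularCard |UNIV :: 'u set|"
    and theory_S: "algebraic_theory S" and theory_T: "algebraic_theory T"
    and morphism: "theory_morphism S T K"
begin

sublocale S: algebras_over \<O> S
  by unfold_locales (rule theory_category[OF theory_S])

sublocale T: algebras_over \<O> T
  by unfold_locales (rule theory_category[OF theory_T])

lemma Ob_S: "Ob S = cardinals" and Ob_T: "Ob T = cardinals"
  using theory_Ob theory_S theory_T by auto

lemma one: "(cardinal_one :: 'u) \<in> cardinals"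
  by (rule cardinal_one_in(1)[OF infinite_universe])

lemma K_Ob: "n \<in> cardinals \<Longrightarrow> omap K n = n"
  using morphism unfolding theory_morphism_def by blast

lemma K_functor: "is_functor S T K"
  using morphism unfolding theory_morphism_def by blast

lemma K_Hom: "f \<in> Hom S m n \<Longrightarrow> amap K f \<in> Hom T m n"
  using functor_Hom[OF S.category K_functor, of f m n] Hom_obs[OF S.category, of f m n]
  by (simp add: Ob_S K_Ob)

lemma K_product:
  fixes I :: "'u set"
  assumes I: "small I" and p: "is_product S I d n p"
  shows "is_product T I d n (\<lambda>i. amap K (p i))"
proof -
  have "is_product T I (\<lambda>i. omap K (d i)) (omap K n) (\<lambda>i. amap K (p i))"
    by (rule theory_morphism_product[OF infinite_universe regular theory_S theory_T morphism I p])
  then have "is_product T I (\<lambda>i. omap K (d i)) n (\<lambda>i. amap K (p i))"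
    using product_Ob[OF p] by (simp add: Ob_S K_Ob)
  then show ?thesis
    by (rule product_factor_cong) (use product_factor_Ob[OF p] in \<open>simp add: Ob_S K_Ob\<close>)
qed

lemma reduct_simps:
  "n \<in> cardinals \<Longrightarrow> omap (reduct S K A) n = omap A n"
  "f \<in> Hom S m n \<Longrightarrow> amap (reduct S K A) f = amap A (amap K f)"
  "f \<in> Hom S m n \<Longrightarrow> action (reduct S K A) f x = action A (amap K f) x"
  by (auto simp: reduct_def Ob_S K_Ob action_def Hom_def)

lemma reduct_in:
  assumes A: "A \<in> algebras T V"
  shows "reduct S K A \<in> algebras S V"
proof -
  let ?R = "reduct S K A"
  have AF: "is_functor T V A"
    using A unfolding algebras_def by blast
  have obs: "m \<in> cardinals" "n \<in> cardinals" if "f \<in> Hom S m n" for f m n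
    using Hom_obs[OF S.category that] by (auto simp: Ob_S)
  have "is_functor S V ?R"
    unfolding is_functor_def
  proof (intro conjI ballI)
    show "omap ?R n \<in> Ob V" if "n \<in> Ob S" for n
      using T.algebra_carrier[OF A, of n] that by (simp add: reduct_simps Ob_S Ob_T monotone_Ob)
    show "amap ?R f \<in> Hom V (omap ?R m) (omap ?R n)" if f: "f \<in> Hom S m n" for f m n
      using T.algebra_Hom[OF A K_Hom[OF f]] by (simp add: reduct_simps(1) reduct_simps(2)[OF f] obs[OF f])
    show "amap ?R (Id S n) = Id V (omap ?R n)" if n: "n \<in> Ob S" for n
    proof -
      have "amap K (Id S n) = Id T n"
        using K_functor n K_Ob unfolding is_functor_def Ob_S by auto
      moreover have "amap A (Id T n) = Id V (omap A n)"
        using AF n unfolding is_functor_def Ob_S Ob_T by blast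
      ultimately show ?thesis
        using n by (simp add: reduct_simps(1) reduct_simps(2)[OF Hom_id[OF S.category n]] Ob_S)
    qed
    show "amap ?R (g \<cdot>\<^bsub>S\<^esub> f) = amap ?R g \<cdot>\<^bsub>V\<^esub> amap ?R f"
      if f: "f \<in> Hom S k m" and g: "g \<in> Hom S m n" for f g k m n
      unfolding reduct_simps(2)[OF f] reduct_simps(2)[OF g] reduct_simps(2)[OF Hom_comp[OF S.category f g]]
        functor_comp[OF S.category K_functor f g]
      by (rule functor_comp[OF T.category AF K_Hom[OF f] K_Hom[OF g]])
  qed
  moreover have "preserves_products S V ?R TYPE('u)"
    unfolding preserves_products_def
  proof (intro allI impI)
    fix I :: "'u set" and d n p assume I: "small I" and p: "is_product S I d n p"
    have "is_product V I (\<lambda>i. omap A (d i)) (omap A n) (\<lambda>i. amap A (amap K (p i)))"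
      using A I K_product[OF I p] unfolding algebras_def preserves_products_def by blast
    then have "is_product V I (\<lambda>i. omap A (d i)) (omap A n) (\<lambda>i. amap ?R (p i))"
      by (rule product_cong) (simp add: reduct_simps(2)[OF product_Hom[OF p]])
    moreover have "omap ?R n = omap A n"
      using product_Ob[OF p] by (simp add: reduct_simps(1) Ob_S)
    ultimately have "is_product V I (\<lambda>i. omap A (d i)) (omap ?R n) (\<lambda>i. amap ?R (p i))"
      by simp
    then show "is_product V I (\<lambda>i. omap ?R (d i)) (omap ?R n) (\<lambda>i. amap ?R (p i))"
      by (rule product_factor_cong) (use product_factor_Ob[OF p] in \<open>simp add: reduct_simps(1) Ob_S\<close>)
  qed
  moreover have "omap ?R \<in> extensional (Ob S)" "amap ?R \<in> extensional (Arr S)"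
    by (simp_all add: reduct_def)
  ultimately show ?thesis
    unfolding algebras_def by blast
qed

lemma algebraic_functor_Ob: "omap (algebraic_functor S K) = reduct S K"
  by (simp add: algebraic_functor_def)

lemma component_algebraic_functor:
  "n \<in> cardinals \<Longrightarrow> component (amap (algebraic_functor S K) \<tau>) n x = component \<tau> n x"
  by (simp add: component_def algebraic_functor_def Ob_S K_Ob)

lemma algebraic_functor_Hom:
  assumes \<tau>: "\<tau> \<in> Hom (Alg T V) A B"
  shows "amap (algebraic_functor S K) \<tau> \<in> Hom (Alg S V) (reduct S K A) (reduct S K B)"
  unfolding Alg_Hom_iff
proof (intro conjI ballI)
  let ?F = "amap (algebraic_functor S K) \<tau>"
  note A = T.Alg_HomD(1)[OF \<tau>] and B = T.Alg_HomD(2)[OF \<tau>]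
  show "reduct S K A \<in> algebras S V" "reduct S K B \<in> algebras S V"
    by (rule reduct_in[OF A], rule reduct_in[OF B])
  show "src ?F = reduct S K A" "tgt ?F = reduct S K B" "content ?F \<in> extensional (Ob S)"
    using T.Alg_HomD(3,4)[OF \<tau>] by (auto simp: algebraic_functor_def)
  have content: "content ?F n = content \<tau> n" if "n \<in> cardinals" for n
    using that by (simp add: algebraic_functor_def Ob_S K_Ob)
  show "content ?F n \<in> Hom V (omap (reduct S K A) n) (omap (reduct S K B) n)" if "n \<in> Ob S" for n
    using T.Alg_HomD(5)[OF \<tau>, of n] that by (simp add: content reduct_simps Ob_S Ob_T)
  show "content ?F n \<cdot>\<^bsub>V\<^esub> amap (reduct S K A) f = amap (reduct S K B) f \<cdot>\<^bsub>V\<^esub> content ?F m"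
    if "m \<in> Ob S" "n \<in> Ob S" and f: "f \<in> Hom S m n" for m n f
    using \<tau> that K_Hom[OF f] unfolding Alg_Hom_iff
    by (simp add: content reduct_simps(2)[OF f] Ob_S Ob_T)
qed

lemma algebraic_functor_functor: "is_functor (Alg T V) (Alg S V) (algebraic_functor S K)"
  unfolding is_functor_def Alg_Ob algebraic_functor_Ob
proof (intro conjI ballI)
  let ?F = "amap (algebraic_functor S K)"
  show "reduct S K A \<in> algebras S V" if "A \<in> algebras T V" for A
    using that by (rule reduct_in)
  show "?F \<tau> \<in> Hom (Alg S V) (reduct S K A) (reduct S K B)" if "\<tau> \<in> Hom (Alg T V) A B" for A B \<tau>
    using that by (rule algebraic_functor_Hom)
  show "?F (Id (Alg T V) A) = Id (Alg S V) (reduct S K A)" if A: "A \<in> algebras T V" for A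
    by (rule S.Alg_Hom_eqI[OF algebraic_functor_Hom[OF T.Alg_id(1)[OF A]] S.Alg_id(1)[OF reduct_in[OF A]]])
      (simp add: Ob_S Ob_T component_algebraic_functor reduct_simps(1) T.Alg_id(2)[OF A] S.Alg_id(2)[OF reduct_in[OF A]])
  show "?F (\<tau> \<cdot>\<^bsub>Alg T V\<^esub> \<sigma>) = ?F \<tau> \<cdot>\<^bsub>Alg S V\<^esub> ?F \<sigma>"
    if \<sigma>: "\<sigma> \<in> Hom (Alg T V) A B" and \<tau>: "\<tau> \<in> Hom (Alg T V) B D" for A B D \<sigma> \<tau>
    by (rule S.Alg_Hom_eqI[OF algebraic_functor_Hom[OF T.Alg_comp(1)[OF \<sigma> \<tau>]]
          S.Alg_comp(1)[OF algebraic_functor_Hom[OF \<sigma>] algebraic_functor_Hom[OF \<tau>]]])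
      (simp add: Ob_S Ob_T component_algebraic_functor reduct_simps(1) T.Alg_comp(2)[OF \<sigma> \<tau>]
        S.Alg_comp(2)[OF algebraic_functor_Hom[OF \<sigma>] algebraic_functor_Hom[OF \<tau>]])
qed

lemma algebraic_functor_monotone: "monotone_on_homs (Alg T V) (Alg S V) (algebraic_functor S K)"
  unfolding monotone_on_homs_def
proof (intro ballI impI)
  fix A B \<sigma> \<tau>
  assume \<sigma>: "\<sigma> \<in> Hom (Alg T V) A B" and \<tau>: "\<tau> \<in> Hom (Alg T V) A B" and le: "Le (Alg T V) \<sigma> \<tau>"
  have oneS: "cardinal_one \<in> Ob S" and oneT: "cardinal_one \<in> Ob T"
    using one by (simp_all add: Ob_S Ob_T)
  show "Le (Alg S V) (amap (algebraic_functor S K) \<sigma>) (amap (algebraic_functor S K) \<tau>)"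
    using le
    unfolding T.Alg_Le[OF \<sigma> \<tau> oneT] S.Alg_Le[OF algebraic_functor_Hom[OF \<sigma>] algebraic_functor_Hom[OF \<tau>] oneS]
    by (simp add: component_algebraic_functor reduct_simps(1) one)
qed

lemma algebraic_functor_preordered: "preordered_functor (Alg T V) (Alg S V) (algebraic_functor S K)"
  unfolding preordered_functor_def
  using T.Alg_preordered S.Alg_preordered one algebraic_functor_functor algebraic_functor_monotone
  by (simp add: Ob_S Ob_T)

lemma algebraic_functor_ordered:
  assumes "\<And>r. r \<in> \<O> \<Longrightarrow> antisym r"
  shows "ordered_functor (Alg T V) (Alg S V) (algebraic_functor S K)"
  unfolding ordered_functor_def
  using T.Alg_ordered[OF theory_T assms] S.Alg_ordered[OF theory_S assms]
    algebraic_functor_functor algebraic_functor_monotone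
  by blast

end

section \<open>Strong order-solidity\<close>

context theory_morphism_over
begin

interpretation ord: algebras_over preorders T
  by (rule T.over_preorders)

text \<open>
  Being preorder-varietal provides the free algebra \<open>F\<close> as a preordered algebra also when \<open>\<O>\<close>
  consists of posets; it is the quotient \<open>A\<close> that takes its values in \<open>\<O>\<close>. In \<open>extends B f h\<close>, the homomorphism \<open>h\<close> out of \<open>F\<close> is the one
  induced by the cocone \<open>f\<close>.
\<close>

lemma algebraic_functor_solid:
  assumes varietal: "preorder_varietal T"
  shows "strongly_order_solid TYPE('i) (Alg T V) (Alg S V) (algebraic_functor S K)"
  unfolding strongly_order_solid_def Alg_Ob algebraic_functor_Ob
proof (intro allI impI)
  fix I :: "'i set" and D X \<xi>
  assume X: "X \<in> algebras S V"
    and D\<xi>: "\<forall>i\<in>I. D i \<in> algebras T V \<and> \<xi> i \<in> Hom (Alg S V) (reduct S K (D i)) X"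
  let ?U = "algebraic_functor S K"
  have D: "D i \<in> algebras T V" and \<xi>: "\<xi> i \<in> Hom (Alg S V) (reduct S K (D i)) X" if "i \<in> I" for i
    using D\<xi> that by auto
  have oneS: "cardinal_one \<in> Ob S" and oneT: "cardinal_one \<in> Ob T"
    using one by (simp_all add: Ob_S Ob_T)
  have underlying: "omap underlying A = omap A cardinal_one"
    "amap underlying \<tau> = content \<tau> cardinal_one" for A :: "('u, 't) algebra" and \<tau>
    by (simp_all add: underlying_def)
  let ?X1 = "omap X cardinal_one"
  have X1: "?X1 \<in> preorders"
    using S.algebra_carrier[OF X oneS] T.sub_preorders by blast
  obtain F e where univ: "universal_arrow (Alg T PreV) PreV underlying ?X1 F e"
    and epic: "order_epic (Alg T PreV) PreV underlying F e"
    using varietal X1 unfolding preorder_varietal_def order_right_adjoint_def Ord_eq monotone_Ob by blast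
  have F: "F \<in> algebras T PreV" and e: "e \<in> Hom PreV ?X1 (omap F cardinal_one)"
    using univ unfolding universal_arrow_def Alg_Ob underlying by auto
  have ex1: "\<exists>!t. t \<in> Hom (Alg T PreV) F B \<and> content t cardinal_one \<cdot>\<^bsub>PreV\<^esub> e = f"
    if "B \<in> algebras T PreV" "f \<in> Hom PreV ?X1 (omap B cardinal_one)" for B f
    using univ that unfolding universal_arrow_def Alg_Ob underlying by blast
  define c where "c = content e"
  have c: "c z \<in> Field (omap F cardinal_one)" if "z \<in> Field ?X1" for z
    unfolding c_def by (rule monotone_HomD(1)[OF e that])
  have et: "content t cardinal_one \<cdot>\<^bsub>PreV\<^esub> e \<in> Hom PreV ?X1 (omap B cardinal_one)"
    "z \<in> Field ?X1 \<Longrightarrow> content (content t cardinal_one \<cdot>\<^bsub>PreV\<^esub> e) z = component t cardinal_one (c z)"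
    if t: "t \<in> Hom (Alg T PreV) F B" for t B z
    using monotone_Hom_comp[OF e ord.Alg_HomD(5)[OF t oneT]]
    by (simp_all add: component_def c_def monotone_comp monotone_src[OF e])
  have F_ext: "t = t'"
    if t: "t \<in> Hom (Alg T PreV) F B" and t': "t' \<in> Hom (Alg T PreV) F B"
      and eq: "\<And>z. z \<in> Field ?X1 \<Longrightarrow> component t cardinal_one (c z) = component t' cardinal_one (c z)"
    for t t' B
  proof -
    have "content t cardinal_one \<cdot>\<^bsub>PreV\<^esub> e = content t' cardinal_one \<cdot>\<^bsub>PreV\<^esub> e"
      by (rule monotone_Hom_eqI[OF et(1)[OF t] et(1)[OF t']]) (simp add: et(2)[OF t] et(2)[OF t'] eq)
    then show ?thesis
      using ex1[OF ord.Alg_HomD(2)[OF t] et(1)[OF t]] t t' by metis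
  qed
  have F_le: "Le (Alg T PreV) t t'"
    if t: "t \<in> Hom (Alg T PreV) F B" and t': "t' \<in> Hom (Alg T PreV) F B"
      and le: "\<And>z. z \<in> Field ?X1 \<Longrightarrow>
        (component t cardinal_one (c z), component t' cardinal_one (c z)) \<in> omap B cardinal_one"
    for t t' B
  proof -
    have "Le PreV (amap underlying t \<cdot>\<^bsub>PreV\<^esub> e) (amap underlying t' \<cdot>\<^bsub>PreV\<^esub> e)"
      unfolding monotone_Le underlying monotone_src[OF et(1)[OF t]] monotone_tgt[OF et(1)[OF t]]
      by (simp add: et(2)[OF t] et(2)[OF t'] le)
    then show ?thesis
      using epic t t' ord.Alg_HomD(2)[OF t] unfolding order_epic_def Alg_Ob by blast
  qed

  define cocone where "cocone B f \<longleftrightarrow> B \<in> algebras T V \<and> f \<in> Hom (Alg S V) X (reduct S K B) \<and>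
    (\<exists>\<beta>. \<forall>i\<in>I. \<beta> i \<in> Hom (Alg T V) (D i) B \<and> amap ?U (\<beta> i) = f \<cdot>\<^bsub>Alg S V\<^esub> \<xi> i)" for B f
  define extends where "extends B f h \<longleftrightarrow> cocone B f \<and> h \<in> Hom (Alg T PreV) F B \<and>
    (\<forall>z \<in> Field ?X1. component h cardinal_one (c z) = component f cardinal_one z)" for B f h
  have coconeD: "B \<in> algebras T V" "f \<in> Hom (Alg S V) X (reduct S K B)" if "extends B f h" for B f h
    using that unfolding extends_def cocone_def by auto
  have extD: "h \<in> Hom (Alg T PreV) F B" "z \<in> Field ?X1 \<Longrightarrow> component h cardinal_one (c z) = component f cardinal_one z"
    if "extends B f h" for B f h z
    using that unfolding extends_def by auto
  have extB: "B \<in> algebras T PreV" if "extends B f h" for B f h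
    using coconeD[OF that] T.algebras_iff_preorders by blast
  have extension: "\<exists>h. extends B f h" if cc: "cocone B f" for B f
  proof -
    have B: "B \<in> algebras T V" and f: "f \<in> Hom (Alg S V) X (reduct S K B)"
      using cc unfolding cocone_def by auto
    have BP: "B \<in> algebras T PreV"
      using B T.algebras_iff_preorders by blast
    have "content f cardinal_one \<in> Hom V ?X1 (omap B cardinal_one)"
      using S.Alg_HomD(5)[OF f oneS] by (simp add: reduct_simps(1) one)
    then have "content f cardinal_one \<in> Hom PreV ?X1 (omap B cardinal_one)"
      using monotone_Hom_superset[OF S.algebra_carrier[OF X oneS] T.algebra_carrier[OF B oneT] T.sub_preorders] by blast
    from ex1[OF BP this] obtain h where h: "h \<in> Hom (Alg T PreV) F B"
      and he: "content h cardinal_one \<cdot>\<^bsub>PreV\<^esub> e = content f cardinal_one"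
      by blast
    have "component h cardinal_one (c z) = component f cardinal_one z" if "z \<in> Field ?X1" for z
      using et(2)[OF h that] unfolding he by (simp add: component_def)
    then show ?thesis
      using cc h unfolding extends_def by blast
  qed
  have f_closed: "component f n x \<in> Field (omap B n)"
    if "extends B f h" "n \<in> cardinals" "x \<in> Field (omap X n)" for B f h n x
    using S.component_closed[OF coconeD(2)[OF that(1)], of n x] that by (simp add: Ob_S reduct_simps(1))
  have f_natural: "component f n (action X g x) = action B (amap K g) (component f m x)"
    if "extends B f h" "g \<in> Hom S m n" "x \<in> Field (omap X m)" for B f h g m n x
    using S.component_natural[OF coconeD(2)[OF that(1)] that(2,3)] by (simp add: reduct_simps(3)[OF that(2)])

  \<comment> \<open>the tuple of the generators of the components of \<open>x\<close>; it exists in \<open>F(n)\<close> because \<open>K\<close> preserves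
    the projections of \<open>n\<close>, and it does not depend on the cocone\<close>
  have "\<exists>y. y \<in> Field (omap F n) \<and> (\<forall>B f h. extends B f h \<longrightarrow> component h n y = component f n x)"
    if n: "n \<in> cardinals" and x: "x \<in> Field (omap X n)" for n x
  proof -
    obtain p where p: "is_product S (below n) (\<lambda>_. cardinal_one) n p"
      using theory_power[OF theory_S n] .
    note Kp = K_product[OF small_below p] and pH = product_Hom[OF p]
    have "c (action X (p i) x) \<in> Field (omap F cardinal_one)" if "i \<in> below n" for i
      by (rule c[OF S.action_closed[OF X pH[OF that] x]])
    then obtain y where y: "y \<in> Field (omap F n)"
      and py: "\<And>i. i \<in> below n \<Longrightarrow> action F (amap K (p i)) y = c (action X (p i) x)"
      by (rule cartesian_tuple[OF ord.algebra_cartesian[OF F small_below Kp], of "\<lambda>i. c (action X (p i) x)"]) blast+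
    have "component h n y = component f n x" if ex: "extends B f h" for B f h
    proof (rule cartesian_eq[OF ord.algebra_cartesian[OF extB[OF ex] small_below Kp]])
      show "component h n y \<in> Field (omap B n)"
        using ord.component_closed[OF extD(1)[OF ex] _ y] n by (simp add: Ob_T)
      show "component f n x \<in> Field (omap B n)"
        by (rule f_closed[OF ex n x])
      fix i assume i: "i \<in> below n"
      have "action B (amap K (p i)) (component h n y) = component h cardinal_one (c (action X (p i) x))"
        using ord.component_natural[OF extD(1)[OF ex] K_Hom[OF pH[OF i]] y] py[OF i] by simp
      also have "\<dots> = component f cardinal_one (action X (p i) x)"
        by (rule extD(2)[OF ex S.action_closed[OF X pH[OF i] x]])
      also have "\<dots> = action B (amap K (p i)) (component f n x)"
        by (rule f_natural[OF ex pH[OF i] x])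
      finally show "action B (amap K (p i)) (component h n y) = action B (amap K (p i)) (component f n x)" .
    qed
    then show ?thesis
      using y by blast
  qed
  then obtain lift where lift: "\<And>n x. n \<in> cardinals \<Longrightarrow> x \<in> Field (omap X n) \<Longrightarrow> lift n x \<in> Field (omap F n)"
    and lift_ext: "\<And>n x B f h. n \<in> cardinals \<Longrightarrow> x \<in> Field (omap X n) \<Longrightarrow> extends B f h \<Longrightarrow>
      component h n (lift n x) = component f n x"
    by metis

  obtain A p where A: "A \<in> algebras T V" and p: "p \<in> Hom (Alg T PreV) F A"
    and surj: "\<And>n y. n \<in> Ob T \<Longrightarrow> y \<in> Field (omap A n) \<Longrightarrow> \<exists>x \<in> Field (omap F n). component p n x = y"
    and p_le: "\<And>n x y. \<lbrakk>n \<in> Ob T; x \<in> Field (omap F n); y \<in> Field (omap F n)\<rbrakk> \<Longrightarrow>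
      (component p n x, component p n y) \<in> omap A n \<longleftrightarrow>
      (\<forall>B h. (\<exists>f. extends B f h) \<longrightarrow> (component h n x, component h n y) \<in> omap B n)"
    and p_eq: "\<And>n x y. \<lbrakk>n \<in> Ob T; x \<in> Field (omap F n); y \<in> Field (omap F n)\<rbrakk> \<Longrightarrow>
      component p n x = component p n y \<longleftrightarrow>
      (\<forall>B h. (\<exists>f. extends B f h) \<longrightarrow> component h n x = component h n y)"
    by (rule T.source_factorization[OF F, of "\<lambda>B h. \<exists>f. extends B f h"]) (use coconeD(1) extD(1) in blast)+
  have A': "A \<in> algebras T PreV"
    using A T.algebras_iff_preorders by blast
  have p_eqI: "component p n x = component p n y"
    if "n \<in> cardinals" "x \<in> Field (omap F n)" "y \<in> Field (omap F n)"
      "\<And>B f h. extends B f h \<Longrightarrow> component h n x = component h n y" for n x y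
    using p_eq[of n x y] that by (auto simp: Ob_T)
  define q where "q n x = component p n (lift n x)" for n x
  have q_closed: "q n x \<in> Field (omap A n)" if "n \<in> cardinals" "x \<in> Field (omap X n)" for n x
    unfolding q_def using ord.component_closed[OF p _ lift[OF that]] that by (simp add: Ob_T)
  have q_mono: "(q n x, q n y) \<in> omap A n" if n: "n \<in> cardinals" and xy: "(x, y) \<in> omap X n" for n x y
  proof -
    have "(component f n x, component f n y) \<in> omap B n" if "extends B f h" for B f h
      using S.component_mono[OF coconeD(2)[OF that], of n x y] n xy by (simp add: Ob_S reduct_simps(1))
    then show ?thesis
      using p_le[of n "lift n x" "lift n y"] lift[OF n] lift_ext[OF n] n FieldI1[OF xy] FieldI2[OF xy]
      unfolding q_def by (auto simp: Ob_T)
  qed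
  let ?q = "make_hom S X (reduct S K A) q"
  have q: "?q \<in> Hom (Alg S V) X (reduct S K A)"
  proof (rule S.make_hom_in[OF X reduct_in[OF A]])
    show "q n x \<in> Field (omap (reduct S K A) n)" if "n \<in> Ob S" "x \<in> Field (omap X n)" for n x
      using that q_closed by (simp add: Ob_S reduct_simps(1))
    show "(q n x, q n y) \<in> omap (reduct S K A) n" if "n \<in> Ob S" "(x, y) \<in> omap X n" for n x y
      using that q_mono by (simp add: Ob_S reduct_simps(1))
    fix g m n x assume g: "g \<in> Hom S m n" and x: "x \<in> Field (omap X m)"
    have mn: "m \<in> cardinals" "n \<in> cardinals"
      using Hom_obs[OF S.category g] by (auto simp: Ob_S)
    note gx = S.action_closed[OF X g x] and lx = lift[OF mn(1) x]
    have "component p n (lift n (action X g x)) = component p n (action F (amap K g) (lift m x))"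
    proof (rule p_eqI[OF mn(2) lift[OF mn(2) gx] ord.action_closed[OF F K_Hom[OF g] lx]])
      fix B f h assume ex: "extends B f h"
      show "component h n (lift n (action X g x)) = component h n (action F (amap K g) (lift m x))"
        by (simp only: lift_ext[OF mn(2) gx ex] f_natural[OF ex g x] lift_ext[OF mn(1) x ex]
            ord.component_natural[OF extD(1)[OF ex] K_Hom[OF g] lx])
    qed
    then show "q n (action X g x) = action (reduct S K A) g (q m x)"
      unfolding q_def reduct_simps(3)[OF g] ord.component_natural[OF p K_Hom[OF g] lx, symmetric] .
  qed
  have q_one: "q cardinal_one z = component p cardinal_one (c z)" if z: "z \<in> Field ?X1" for z
    unfolding q_def
    by (rule p_eqI[OF one lift[OF one z] c[OF z]]) (simp only: lift_ext[OF one z] extD(2)[OF _ z])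
  \<comment> \<open>the only possible choice, as \<open>A\<close> and its reduct have the same carriers\<close>
  let ?\<alpha> = "\<lambda>i. make_hom T (D i) A (\<lambda>n d. q n (component (\<xi> i) n d))"
  have \<xi>_closed: "component (\<xi> i) n d \<in> Field (omap X n)"
    if "i \<in> I" "n \<in> cardinals" "d \<in> Field (omap (D i) n)" for i n d
    using S.component_closed[OF \<xi>[OF that(1)], of n d] that by (simp add: Ob_S reduct_simps(1))
  have f\<xi>: "component f n (component (\<xi> i) n d) = component b n d"
    if "amap ?U b = f \<cdot>\<^bsub>Alg S V\<^esub> \<xi> i" "f \<in> Hom (Alg S V) X (reduct S K B)"
      "i \<in> I" "n \<in> cardinals" "d \<in> Field (omap (D i) n)" for f i b B n d
    using S.Alg_comp(2)[OF \<xi>[OF that(3)] that(2), of n d] that(4,5) component_algebraic_functor[of n b d]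
    unfolding that(1)[symmetric] by (simp add: Ob_S reduct_simps(1))
  have \<alpha>: "?\<alpha> i \<in> Hom (Alg T V) (D i) A" if i: "i \<in> I" for i
  proof (rule T.make_hom_in[OF D[OF i] A])
    show "q n (component (\<xi> i) n d) \<in> Field (omap A n)" if "n \<in> Ob T" "d \<in> Field (omap (D i) n)" for n d
      using q_closed \<xi>_closed[OF i] that by (simp add: Ob_T)
    show "(q n (component (\<xi> i) n d), q n (component (\<xi> i) n d')) \<in> omap A n"
      if "n \<in> Ob T" "(d, d') \<in> omap (D i) n" for n d d'
      using q_mono S.component_mono[OF \<xi>[OF i], of n d d'] that by (simp add: Ob_T Ob_S reduct_simps(1))
    fix g m n d assume g: "g \<in> Hom T m n" and d: "d \<in> Field (omap (D i) m)"
    have mn: "m \<in> cardinals" "n \<in> cardinals"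
      using Hom_obs[OF T.category g] by (auto simp: Ob_T)
    note gd = T.action_closed[OF D[OF i] g d]
    note \<xi>d = \<xi>_closed[OF i mn(1) d] and \<xi>gd = \<xi>_closed[OF i mn(2) gd]
    note ld = lift[OF mn(1) \<xi>d]
    have "component p n (lift n (component (\<xi> i) n (action (D i) g d)))
        = component p n (action F g (lift m (component (\<xi> i) m d)))"
    proof (rule p_eqI[OF mn(2) lift[OF mn(2) \<xi>gd] ord.action_closed[OF F g ld]])
      fix B f h assume ex: "extends B f h"
      obtain \<beta> where \<beta>: "\<beta> i \<in> Hom (Alg T V) (D i) B" and U\<beta>: "amap ?U (\<beta> i) = f \<cdot>\<^bsub>Alg S V\<^esub> \<xi> i"
        using ex i unfolding extends_def cocone_def by blast
      note f\<xi>' = f\<xi>[OF U\<beta> coconeD(2)[OF ex] i]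
      show "component h n (lift n (component (\<xi> i) n (action (D i) g d)))
          = component h n (action F g (lift m (component (\<xi> i) m d)))"
        by (simp only: lift_ext[OF mn(2) \<xi>gd ex] lift_ext[OF mn(1) \<xi>d ex] f\<xi>'[OF mn(2) gd] f\<xi>'[OF mn(1) d]
            ord.component_natural[OF extD(1)[OF ex] g ld] T.component_natural[OF \<beta> g d])
    qed
    then show "q n (component (\<xi> i) n (action (D i) g d)) = action A g (q m (component (\<xi> i) m d))"
      unfolding q_def ord.component_natural[OF p g ld, symmetric] .
  qed
  have U\<alpha>: "amap ?U (?\<alpha> i) = ?q \<cdot>\<^bsub>Alg S V\<^esub> \<xi> i" if i: "i \<in> I" for i
    by (rule S.Alg_Hom_eqI[OF algebraic_functor_Hom[OF \<alpha>[OF i]] S.Alg_comp(1)[OF \<xi>[OF i] q]])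
      (simp add: Ob_S Ob_T component_algebraic_functor reduct_simps(1) component_make_hom
        S.Alg_comp(2)[OF \<xi>[OF i] q] \<xi>_closed[OF i])
  have qt: "component (amap ?U t \<cdot>\<^bsub>Alg S V\<^esub> ?q) n x = component t n (q n x)"
    if "t \<in> Hom (Alg T V) A B" "n \<in> cardinals" "x \<in> Field (omap X n)" for t B n x
    using S.Alg_comp(2)[OF q algebraic_functor_Hom[OF that(1)], of n x] that
    by (simp add: Ob_S component_algebraic_functor component_make_hom)
  have tp: "t \<cdot>\<^bsub>Alg T PreV\<^esub> p \<in> Hom (Alg T PreV) F B"
    "n \<in> cardinals \<Longrightarrow> x \<in> Field (omap F n) \<Longrightarrow>
      component (t \<cdot>\<^bsub>Alg T PreV\<^esub> p) n x = component t n (component p n x)"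
    if "t \<in> Hom (Alg T V) A B" for t B n x
  proof -
    have t: "t \<in> Hom (Alg T PreV) A B"
      using T.Alg_Hom_preorders[OF A T.Alg_HomD(2)[OF that]] that by blast
    show "t \<cdot>\<^bsub>Alg T PreV\<^esub> p \<in> Hom (Alg T PreV) F B"
      by (rule ord.Alg_comp(1)[OF p t])
    show "component (t \<cdot>\<^bsub>Alg T PreV\<^esub> p) n x = component t n (component p n x)"
      if "n \<in> cardinals" "x \<in> Field (omap F n)"
      using ord.Alg_comp(2)[OF p t, of n x] that by (simp add: Ob_T)
  qed

  show "\<exists>A \<alpha> q. A \<in> algebras T V \<and> (\<forall>i\<in>I. \<alpha> i \<in> Hom (Alg T V) (D i) A) \<and>
      q \<in> Hom (Alg S V) X (reduct S K A) \<and>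
      (\<forall>i\<in>I. amap ?U (\<alpha> i) = q \<cdot>\<^bsub>Alg S V\<^esub> \<xi> i) \<and>
      (\<forall>B\<in>algebras T V. \<forall>\<beta> f. (\<forall>i\<in>I. \<beta> i \<in> Hom (Alg T V) (D i) B) \<longrightarrow>
         f \<in> Hom (Alg S V) X (reduct S K B) \<longrightarrow>
         (\<forall>i\<in>I. amap ?U (\<beta> i) = f \<cdot>\<^bsub>Alg S V\<^esub> \<xi> i) \<longrightarrow>
         (\<exists>!t. t \<in> Hom (Alg T V) A B \<and> (\<forall>i\<in>I. t \<cdot>\<^bsub>Alg T V\<^esub> \<alpha> i = \<beta> i) \<and>
           amap ?U t \<cdot>\<^bsub>Alg S V\<^esub> q = f)) \<and>
      order_epic (Alg T V) (Alg S V) ?U A q"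
  proof (rule exI[of _ A], rule exI[of _ ?\<alpha>], rule exI[of _ ?q], intro conjI ballI allI impI)
    show "A \<in> algebras T V" "?q \<in> Hom (Alg S V) X (reduct S K A)"
      by (rule A, rule q)
    show "?\<alpha> i \<in> Hom (Alg T V) (D i) A" "amap ?U (?\<alpha> i) = ?q \<cdot>\<^bsub>Alg S V\<^esub> \<xi> i" if "i \<in> I" for i
      by (rule \<alpha>[OF that], rule U\<alpha>[OF that])
  next
    fix B \<beta> f
    assume B: "B \<in> algebras T V" and \<beta>: "\<forall>i\<in>I. \<beta> i \<in> Hom (Alg T V) (D i) B"
      and f: "f \<in> Hom (Alg S V) X (reduct S K B)" and U\<beta>: "\<forall>i\<in>I. amap ?U (\<beta> i) = f \<cdot>\<^bsub>Alg S V\<^esub> \<xi> i"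
    have "cocone B f"
      unfolding cocone_def using B f \<beta> U\<beta> by blast
    then obtain h where ex: "extends B f h"
      using extension by blast
    obtain t where t': "t \<in> Hom (Alg T PreV) A B"
      and tph: "\<And>n x. n \<in> Ob T \<Longrightarrow> x \<in> Field (omap F n) \<Longrightarrow> component t n (component p n x) = component h n x"
    proof (rule T.hom_factor[OF p extD(1)[OF ex] surj])
      show "(component h n x, component h n y) \<in> omap B n"
        if "n \<in> Ob T" "x \<in> Field (omap F n)" "y \<in> Field (omap F n)"
          "(component p n x, component p n y) \<in> omap A n" for n x y
        using p_le[OF that(1-3)] that(4) ex by blast
      show "component h n x = component h n y"
        if "n \<in> Ob T" "x \<in> Field (omap F n)" "y \<in> Field (omap F n)"
          "component p n x = component p n y" for n x y
        using p_eq[OF that(1-3)] that(4) ex by blast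
    qed blast+
    have t: "t \<in> Hom (Alg T V) A B"
      using t' T.Alg_Hom_preorders[OF A B] by blast
    have tq: "component t n (q n x) = component f n x" if "n \<in> cardinals" "x \<in> Field (omap X n)" for n x
      unfolding q_def using tph[OF _ lift[OF that]] lift_ext[OF that ex] that by (simp add: Ob_T)
    show "\<exists>!t. t \<in> Hom (Alg T V) A B \<and> (\<forall>i\<in>I. t \<cdot>\<^bsub>Alg T V\<^esub> ?\<alpha> i = \<beta> i) \<and> amap ?U t \<cdot>\<^bsub>Alg S V\<^esub> ?q = f"
    proof (rule ex1I[of _ t], intro conjI ballI)
      show "t \<in> Hom (Alg T V) A B" by (rule t)
      show "t \<cdot>\<^bsub>Alg T V\<^esub> ?\<alpha> i = \<beta> i" if i: "i \<in> I" for i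
      proof (rule T.Alg_Hom_eqI[OF T.Alg_comp(1)[OF \<alpha>[OF i] t] bspec[OF \<beta> i]])
        fix n d assume n: "n \<in> Ob T" and d: "d \<in> Field (omap (D i) n)"
        have nc: "n \<in> cardinals" using n by (simp add: Ob_T)
        show "component (t \<cdot>\<^bsub>Alg T V\<^esub> ?\<alpha> i) n d = component (\<beta> i) n d"
          unfolding T.Alg_comp(2)[OF \<alpha>[OF i] t n d] component_make_hom[OF n d] tq[OF nc \<xi>_closed[OF i nc d]]
          by (rule f\<xi>[OF bspec[OF U\<beta> i] f i nc d])
      qed
      show "amap ?U t \<cdot>\<^bsub>Alg S V\<^esub> ?q = f"
        by (rule S.Alg_Hom_eqI[OF S.Alg_comp(1)[OF q algebraic_functor_Hom[OF t]] f])
          (simp add: qt[OF t] tq Ob_S)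
      fix t2 assume "t2 \<in> Hom (Alg T V) A B \<and> (\<forall>i\<in>I. t2 \<cdot>\<^bsub>Alg T V\<^esub> ?\<alpha> i = \<beta> i) \<and> amap ?U t2 \<cdot>\<^bsub>Alg S V\<^esub> ?q = f"
      then have t2: "t2 \<in> Hom (Alg T V) A B" and t2q: "amap ?U t2 \<cdot>\<^bsub>Alg S V\<^esub> ?q = f"
        by auto
      \<comment> \<open>both composites with \<open>p\<close> extend \<open>f\<close> along the unit of the free algebra\<close>
      have "t2 \<cdot>\<^bsub>Alg T PreV\<^esub> p = t \<cdot>\<^bsub>Alg T PreV\<^esub> p"
      proof (rule F_ext[OF tp(1)[OF t2] tp(1)[OF t]])
        fix z assume z: "z \<in> Field ?X1"
        show "component (t2 \<cdot>\<^bsub>Alg T PreV\<^esub> p) cardinal_one (c z) = component (t \<cdot>\<^bsub>Alg T PreV\<^esub> p) cardinal_one (c z)"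
          unfolding tp(2)[OF t2 one c[OF z]] tp(2)[OF t one c[OF z]] q_one[OF z, symmetric]
            qt[OF t2 one z, symmetric] t2q tq[OF one z] ..
      qed
      then have eq: "component t2 n (component p n x) = component t n (component p n x)"
        if "n \<in> cardinals" "x \<in> Field (omap F n)" for n x
        using tp(2)[OF t2 that] tp(2)[OF t that] by simp
      show "t2 = t"
      proof (rule T.Alg_Hom_eqI[OF t2 t])
        fix n y assume n: "n \<in> Ob T" and y: "y \<in> Field (omap A n)"
        then show "component t2 n y = component t n y"
          using surj[OF n y] eq[of n] by (auto simp: Ob_T)
      qed
    qed
  next
    show "order_epic (Alg T V) (Alg S V) ?U A ?q"
      unfolding order_epic_def Alg_Ob
    proof (intro ballI impI)
      fix B r s assume B: "B \<in> algebras T V" and r: "r \<in> Hom (Alg T V) A B" and s: "s \<in> Hom (Alg T V) A B"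
        and le: "Le (Alg S V) (amap ?U r \<cdot>\<^bsub>Alg S V\<^esub> ?q) (amap ?U s \<cdot>\<^bsub>Alg S V\<^esub> ?q)"
      have le': "(component r cardinal_one (q cardinal_one z), component s cardinal_one (q cardinal_one z)) \<in> omap B cardinal_one"
        if z: "z \<in> Field ?X1" for z
        using le z unfolding S.Alg_Le[OF S.Alg_comp(1)[OF q algebraic_functor_Hom[OF r]]
            S.Alg_comp(1)[OF q algebraic_functor_Hom[OF s]] oneS]
        by (simp add: qt[OF r one] qt[OF s one] reduct_simps(1) one)
      have "Le (Alg T PreV) (r \<cdot>\<^bsub>Alg T PreV\<^esub> p) (s \<cdot>\<^bsub>Alg T PreV\<^esub> p)"
      proof (rule F_le[OF tp(1)[OF r] tp(1)[OF s]])
        fix z assume z: "z \<in> Field ?X1"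
        show "(component (r \<cdot>\<^bsub>Alg T PreV\<^esub> p) cardinal_one (c z), component (s \<cdot>\<^bsub>Alg T PreV\<^esub> p) cardinal_one (c z)) \<in> omap B cardinal_one"
          unfolding tp(2)[OF r one c[OF z]] tp(2)[OF s one c[OF z]] q_one[OF z, symmetric] by (rule le'[OF z])
      qed
      then have F_le': "(component r cardinal_one (component p cardinal_one x), component s cardinal_one (component p cardinal_one x)) \<in> omap B cardinal_one"
        if "x \<in> Field (omap F cardinal_one)" for x
        using that unfolding ord.Alg_Le[OF tp(1)[OF r] tp(1)[OF s] oneT]
        by (simp add: tp(2)[OF r one] tp(2)[OF s one])
      show "Le (Alg T V) r s"
        unfolding T.Alg_Le[OF r s oneT]
      proof
        fix y assume "y \<in> Field (omap A cardinal_one)"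
        then obtain x where "x \<in> Field (omap F cardinal_one)" "component p cardinal_one x = y"
          using surj[OF oneT] by blast
        then show "(component r cardinal_one y, component s cardinal_one y) \<in> omap B cardinal_one"
          using F_le' by blast
      qed
    qed
  qed
qed

end

theorem theorem3p7:
  fixes S :: "('u, 's) category" and T :: "('u, 't) category"
    and K :: "('u, 's, 'u, 't) cfunctor"
  assumes "infinite (UNIV :: 'u set)" and "regularCard |UNIV :: 'u set|"
    and "algebraic_theory S" and "algebraic_theory T"
    and "preorder_varietal S" and "preorder_varietal T"
    and "theory_morphism S T K"
  shows "ordered_functor (Alg T Pos) (Alg S Pos) (algebraic_functor S K) \<and>
         strongly_order_solid TYPE('i) (Alg T Pos) (Alg S Pos) (algebraic_functor S K) \<and>
         preordered_functor (Alg T Ord) (Alg S Ord) (algebraic_functor S K) \<and>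
         strongly_order_solid TYPE('i) (Alg T Ord) (Alg S Ord) (algebraic_functor S K)"
proof -
  interpret pos: theory_morphism_over posets S T K
    by (intro theory_morphism_over.intro separating_posets theory_morphism_over_axioms.intro assms)
  interpret ord: theory_morphism_over preorders S T K
    by (intro theory_morphism_over.intro separating_preorders theory_morphism_over_axioms.intro assms)
  have "antisym r" if "r \<in> posets" for r :: "'u rel"
    using that by (simp add: posets_def partial_order_on_def)
  then show ?thesis
    unfolding Ord_eq Pos_eq
    using pos.algebraic_functor_ordered pos.algebraic_functor_solid[OF assms(6)]
      ord.algebraic_functor_preordered ord.algebraic_functor_solid[OF assms(6)]
    by blast
qed

end
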